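(* For every fixed $\varepsilon>0$ and every $K>0$ there is a constant $C>0$ (depending only on $\varepsilon$ and $K$) such that for every $\delta\in(0,1)$ there is $N_0$ for which the following holds. Let $N\ge N_0$ and $2\le k\le N$ be integers, and let $M\in\mathbb{C}^{N\times N}$ be a unitary matrix all of whose entries have absolute value at most $K/\sqrt{N}$. Then for some positive integer $q\le C\cdot k\cdot\log^2 k\cdot\log N$, if $A\in\mathbb{C}^{q\times N}$ is the random matrix whose $q$ rows are chosen uniformly and independently from the rows of $M$ and multiplied by $\sqrt{N/q}$, then with probability at least $1-\delta$ the matrix $A$ satisfies the restricted isometry property of order $k$ with constant $\varepsilon$.
   Context: A vector $x\in\mathbb{C}^N$ is $k$-sparse if it has at most $k$ nonzero entries. A matrix $A\in\mathbb{C}^{q\times N}$ satisfies the restricted isometry property of order $k$ with constant $\varepsilon$ if for every $k$-sparse vector $x\in\mathbb{C}^N$, $(1-\varepsilon)\|x\|_2^2\le\|Ax\|_2^2\le(1+\varepsilon)\|x\|_2^2$. The rows are chosen with replacement. *)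

theory Defs
  imports "HOL-Probability.Product_PMF" "Jordan_Normal_Form.Schur_Decomposition"
begin

unbundle no vec_syntax

definition unitary_mat :: "complex mat \<Rightarrow> bool" where
  "unitary_mat M \<longleftrightarrow> square_mat M \<and> inverts_mat M (mat_adjoint M) \<and> inverts_mat (mat_adjoint M) M"

definition l2_norm :: "complex vec \<Rightarrow> real" where
  "l2_norm x = L2_set (\<lambda>i. cmod (x $ i)) {..<dim_vec x}"

definition sparse_vec :: "nat \<Rightarrow> complex vec \<Rightarrow> bool" where
  "sparse_vec k x \<longleftrightarrow> card {i. i < dim_vec x \<and> x $ i \<noteq> 0} \<le> k"

definition restricted_isometry :: "complex mat \<Rightarrow> nat \<Rightarrow> real \<Rightarrow> bool" where
  "restricted_isometry A k \<epsilon> \<longleftrightarrow>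
     (\<forall>x \<in> carrier_vec (dim_col A). sparse_vec k x \<longrightarrow>
        (1 - \<epsilon>) * (l2_norm x)\<^sup>2 \<le> (l2_norm (A *\<^sub>v x))\<^sup>2 \<and>
        (l2_norm (A *\<^sub>v x))\<^sup>2 \<le> (1 + \<epsilon>) * (l2_norm x)\<^sup>2)"

definition sampled_mat :: "complex mat \<Rightarrow> nat \<Rightarrow> (nat \<Rightarrow> nat) \<Rightarrow> complex mat" where
  "sampled_mat M q r =
     complex_of_real (sqrt (real (dim_row M) / real q)) \<cdot>\<^sub>m
       mat_of_rows (dim_col M) (map (\<lambda>i. row M (r i)) [0..<q])"

text \<open>
  The law of the random matrix: the row indices \<open>r 0, \<dots>, r (q - 1)\<close> are independent and
  uniform, so rows are drawn with replacement. The second argument of \<^const>\<open>Pi_pmf\<close> is only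
  the dummy value of \<open>r\<close> outside \<open>{..<q}\<close>.
\<close>

definition random_row_sample :: "complex mat \<Rightarrow> nat \<Rightarrow> complex mat pmf" where
  "random_row_sample M q =
     map_pmf (sampled_mat M q) (Pi_pmf {..<q} 0 (\<lambda>_. pmf_of_set {..<dim_row M}))"

end

theory Submission
  imports Defs "HOL-Probability.Hoeffding"
begin

text \<open>
  Let \<open>F j = \<bar>\<langle>\<Phi>\<^sub>j, x\<rangle>\<bar>\<close>, where \<open>\<Phi>\<close> is the matrix scaled to have entries of modulus at most \<open>K\<close>
  and \<open>x\<close> lies in the \<open>\<ell>\<^sub>1\<close> unit ball. We write \<open>F\<^sup>2\<close> as a telescoping sum, over the dyadic scales
  \<open>b = K / 2\<^sup>i\<close> with \<open>1 \<le> i \<le> t = O(log k)\<close>, of slabs \<open>min (2b, F)\<^sup>2 - min (b, F)\<^sup>2\<close>. By Maurey's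
  empirical method, at scale \<open>b\<close> the function \<open>F\<close> agrees up to \<open>\<eta> b\<close>, outside a fraction
  \<open>1 / poly k\<close> of both all indices and the sampled ones, with a member of a finite net of
  cardinality \<open>N\<close> to the power \<open>O(4\<^sup>i log k)\<close>. A slab is bounded by \<open>3 b\<^sup>2\<close>, so a Chernoff bound
  with a relative error \<open>e\<close> and an additive error \<open>e / (3 k t)\<close> fails on one member of the net with
  probability \<open>exp (- c q 4\<^sup>i / (k t))\<close>. The factors \<open>4\<^sup>i\<close> cancel, and a union bound works at every
  scale once \<open>q\<close> is a large multiple of \<open>k log\<^sup>2 k log N\<close>. A \<open>k\<close>-sparse vector of \<open>\<ell>\<^sub>1\<close> norm
  \<open>1\<close> has squared Euclidean norm at least \<open>1 / k\<close>, which absorbs the additive errors.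
\<close>

subsection \<open>Concentration of empirical means\<close>

text \<open>Markov's inequality for the exponential of the sum, whose expectation factors over the
  independent coordinates. The exponential parameter is part of \<open>X\<close>, so that upper and
  lower tails are both instances; finite support makes every function integrable.\<close>

lemma chernoff_Pi_pmf:
  fixes X :: "'a \<Rightarrow> real"
  assumes fin: "finite (set_pmf p)"
    and mgf: "measure_pmf.expectation p (\<lambda>x. exp (X x)) \<le> exp c"
  shows "measure_pmf.prob (Pi_pmf {..<n} d (\<lambda>_. p)) {z. (\<Sum>i<n. X (z i)) \<ge> t} \<le> exp (real n * c - t)"
proof -
  let ?P = "Pi_pmf {..<n} d (\<lambda>_. p)"
  let ?S = "\<lambda>z. exp (\<Sum>i<n. X (z i))"
  have fin': "finite (set_pmf ?P)"
    by (simp add: set_Pi_pmf fin finite_PiE_dflt)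
  have "measure_pmf.prob ?P {z. (\<Sum>i<n. X (z i)) \<ge> t} = measure_pmf.prob ?P {z \<in> space ?P. ?S z \<ge> exp t}"
    by simp
  also have "\<dots> \<le> measure_pmf.expectation ?P ?S / exp t"
    by (rule integral_Markov_inequality_measure[where A = "{}"])
       (auto intro: integrable_measure_pmf_finite fin')
  also have "measure_pmf.expectation ?P ?S = measure_pmf.expectation ?P (\<lambda>z. \<Prod>i\<in>{..<n}. exp (X (z i)))"
    by (simp add: exp_sum)
  also have "\<dots> = measure_pmf.expectation p (\<lambda>x. exp (X x)) ^ n"
    by (subst expectation_prod_Pi_pmf) (auto intro: integrable_measure_pmf_finite fin)
  also have "\<dots> \<le> exp c ^ n"
    by (intro power_mono mgf integral_nonneg_AE) auto
  finally show ?thesis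
    by (simp add: divide_right_mono exp_diff exp_of_nat_mult)
qed

text \<open>By convexity the exponential lies below its chord over \<open>[0, 1]\<close>, and
  \<open>1 + y \<le> exp y\<close> finishes. The sign of \<open>l\<close> is free, as both tails
  need it.\<close>

lemma expectation_exp_bounded:
  fixes X :: "'a \<Rightarrow> real"
  assumes fin: "finite (set_pmf p)" and X: "\<And>x. x \<in> set_pmf p \<Longrightarrow> 0 \<le> X x \<and> X x \<le> 1"
  shows "measure_pmf.expectation p (\<lambda>x. exp (l * X x)) \<le> exp ((exp l - 1) * measure_pmf.expectation p X)"
proof -
  have "measure_pmf.expectation p (\<lambda>x. exp (l * X x)) \<le> measure_pmf.expectation p (\<lambda>x. 1 + (exp l - 1) * X x)"
  proof (rule integral_mono_AE)
    show "AE x in p. exp (l * X x) \<le> 1 + (exp l - 1) * X x"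
    proof (rule AE_pmfI)
      fix x assume "x \<in> set_pmf p"
      then have *: "0 \<le> X x" "X x \<le> 1" using X by auto
      have "exp ((1 - X x) *\<^sub>R 0 + X x *\<^sub>R l) \<le> (1 - X x) * exp 0 + X x * exp l"
        by (rule convex_onD[OF exp_convex]) (use * in auto)
      then show "exp (l * X x) \<le> 1 + (exp l - 1) * X x"
        by (simp add: algebra_simps)
    qed
  qed (auto intro: integrable_measure_pmf_finite fin)
  also have "\<dots> = 1 + (exp l - 1) * measure_pmf.expectation p X"
    by (subst Bochner_Integration.integral_add) (auto intro: integrable_measure_pmf_finite fin)
  also have "\<dots> \<le> exp ((exp l - 1) * measure_pmf.expectation p X)"
    by (rule exp_ge_add_one_self)
  finally show ?thesis .
qed

text \<open>The Chernoff bound with parameters \<open>e\<close> and \<open>-e\<close>. The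
  second-order term of the exponential costs \<open>e\<^sup>2 * m\<close>, which becomes the
  relative error \<open>e\<close> after division by \<open>e\<close>; what remains of the threshold
  is the additive part, so the exponent is linear in \<open>\<alpha> / B\<close> instead of
  quadratic.\<close>

lemma relative_chernoff_Pi_pmf:
  fixes h :: "'a \<Rightarrow> real"
  assumes fin: "finite (set_pmf p)" and h: "\<And>x. x \<in> set_pmf p \<Longrightarrow> 0 \<le> h x \<and> h x \<le> B"
    and B: "B > 0" and e: "0 < e" "e \<le> 1" and n: "n > 0"
  defines "\<mu> \<equiv> measure_pmf.expectation p h"
  shows "measure_pmf.prob (Pi_pmf {..<n} d (\<lambda>_. p))
           {z. \<bar>(\<Sum>i<n. h (z i)) / real n - \<mu>\<bar> > e * \<mu> + \<alpha>} \<le> 2 * exp (- (e * real n * \<alpha> / B))"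
proof -
  let ?P = "Pi_pmf {..<n} d (\<lambda>_. p)"
  define X where "X = (\<lambda>x. h x / B)"
  define m where "m = measure_pmf.expectation p X"
  have m: "m = \<mu> / B" by (simp add: m_def X_def \<mu>_def)
  have X: "0 \<le> X x \<and> X x \<le> 1" if "x \<in> set_pmf p" for x
    using h[OF that] B by (simp add: X_def)
  have m0: "m \<ge> 0" unfolding m_def
    by (rule integral_nonneg_AE, rule AE_pmfI) (use X in auto)
  have sumX: "(\<Sum>i<n. l * X (z i)) = l * ((\<Sum>i<n. h (z i)) / B)" for l z
    by (simp add: X_def sum_distrib_left sum_divide_distrib)
  have up: "exp e - 1 \<le> e + e\<^sup>2" using exp_bound[of e] e by simp
  have dn: "exp (- e) - 1 \<le> - e + e\<^sup>2"
  proof -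
    have "exp (-e) \<le> 1 / (1 + e)"
      using exp_ge_add_one_self[of e] e by (simp add: exp_minus field_simps)
    also have "\<dots> \<le> 1 - e + e\<^sup>2"
      using e by (simp add: field_simps power2_eq_square)
    finally show ?thesis by simp
  qed
  \<comment> \<open>Both tails in one statement, for \<open>l = e\<close> and \<open>l = -e\<close>;
    the threshold is such that everything except the additive part cancels in the exponent.\<close>
  have tail: "measure_pmf.prob ?P {z. (\<Sum>i<n. l * X (z i)) \<ge> real n * (l * m + e\<^sup>2 * m + e * \<alpha> / B)}
      \<le> exp (- (e * real n * \<alpha> / B))" if l: "exp l - 1 \<le> l + e\<^sup>2" for l
  proof -
    have "measure_pmf.prob ?P {z. (\<Sum>i<n. l * X (z i)) \<ge> real n * (l * m + e\<^sup>2 * m + e * \<alpha> / B)}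
      \<le> exp (real n * ((exp l - 1) * m) - real n * (l * m + e\<^sup>2 * m + e * \<alpha> / B))"
      unfolding m_def
      by (rule chernoff_Pi_pmf[OF fin]) (rule expectation_exp_bounded[OF fin X])
    also have "\<dots> \<le> exp (- (e * real n * \<alpha> / B))"
    proof -
      have "(exp l - 1) * m \<le> (l + e\<^sup>2) * m" using l m0 by (rule mult_right_mono)
      then have "real n * ((exp l - 1) * m) \<le> real n * ((l + e\<^sup>2) * m)"
        by (intro mult_left_mono) auto
      then show ?thesis by (simp add: algebra_simps)
    qed
    finally show ?thesis .
  qed
  \<comment> \<open>Multiplying the deviation by \<open>e / B\<close> turns it into one of the two
    tail events, since \<open>e * (e * \<mu>) / B = e\<^sup>2 * m\<close>.\<close>
  have sub: "{z. \<bar>(\<Sum>i<n. h (z i)) / real n - \<mu>\<bar> > e * \<mu> + \<alpha>} \<subseteq>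
     {z. (\<Sum>i<n. e * X (z i)) \<ge> real n * (e * m + e\<^sup>2 * m + e * \<alpha> / B)} \<union>
     {z. (\<Sum>i<n. (-e) * X (z i)) \<ge> real n * ((-e) * m + e\<^sup>2 * m + e * \<alpha> / B)}"
  proof
    fix z assume "z \<in> {z. \<bar>(\<Sum>i<n. h (z i)) / real n - \<mu>\<bar> > e * \<mu> + \<alpha>}"
    then consider "(\<Sum>i<n. h (z i)) / real n - \<mu> \<ge> e * \<mu> + \<alpha>" | "\<mu> - (\<Sum>i<n. h (z i)) / real n \<ge> e * \<mu> + \<alpha>"
      by fastforce
    then show "z \<in> {z. (\<Sum>i<n. e * X (z i)) \<ge> real n * (e * m + e\<^sup>2 * m + e * \<alpha> / B)} \<union>
     {z. (\<Sum>i<n. (-e) * X (z i)) \<ge> real n * ((-e) * m + e\<^sup>2 * m + e * \<alpha> / B)}"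
    proof cases
      case 1
      then have "(\<Sum>i<n. h (z i)) \<ge> real n * (\<mu> + e * \<mu> + \<alpha>)"
        using n by (simp add: field_simps)
      then have "e / B * (\<Sum>i<n. h (z i)) \<ge> e / B * (real n * (\<mu> + e * \<mu> + \<alpha>))"
        by (rule mult_left_mono) (use e B in auto)
      then show ?thesis unfolding sumX m
        by (simp add: algebra_simps add_divide_distrib power2_eq_square)
    next
      case 2
      then have "real n * (\<mu> - e * \<mu> - \<alpha>) \<ge> (\<Sum>i<n. h (z i))"
        using n by (simp add: field_simps)
      then have "e / B * (\<Sum>i<n. h (z i)) \<le> e / B * (real n * (\<mu> - e * \<mu> - \<alpha>))"
        by (rule mult_left_mono) (use e B in auto)
      then show ?thesis unfolding sumX m
        by (simp add: algebra_simps add_divide_distrib diff_divide_distrib power2_eq_square)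
    qed
  qed
  have "measure_pmf.prob ?P {z. \<bar>(\<Sum>i<n. h (z i)) / real n - \<mu>\<bar> > e * \<mu> + \<alpha>} \<le>
      measure_pmf.prob ?P {z. (\<Sum>i<n. e * X (z i)) \<ge> real n * (e * m + e\<^sup>2 * m + e * \<alpha> / B)} +
      measure_pmf.prob ?P {z. (\<Sum>i<n. (-e) * X (z i)) \<ge> real n * ((-e) * m + e\<^sup>2 * m + e * \<alpha> / B)}"
    by (rule order_trans[OF measure_pmf.finite_measure_mono[OF sub] measure_Un_le]) auto
  also have "\<dots> \<le> exp (- (e * real n * \<alpha> / B)) + exp (- (e * real n * \<alpha> / B))"
    by (intro add_mono tail) (use up dn in auto)
  finally show ?thesis by simp
qed

lemma hoeffding_Pi_pmf:
  fixes Y :: "'a \<Rightarrow> real"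
  assumes fin: "finite (set_pmf p)" and Y: "\<And>x. x \<in> set_pmf p \<Longrightarrow> \<bar>Y x\<bar> \<le> R"
    and R: "R > 0" and a: "a > 0"
  shows "measure_pmf.prob (Pi_pmf {..<n} d (\<lambda>_. p))
      {z. (\<Sum>i<n. Y (z i)) \<ge> real n * (measure_pmf.expectation p Y + a)} \<le> exp (- (real n * a\<^sup>2 / (2 * R\<^sup>2)))"
proof -
  let ?m = "measure_pmf.expectation p Y"
  \<comment> \<open>This is the minimiser of the exponent
    \<open>l\<^sup>2 * R\<^sup>2 / 2 - l * a\<close>.\<close>
  define l where "l = a / R\<^sup>2"
  have l: "l > 0" using a R by (simp add: l_def)
  interpret interval_bounded_random_variable "measure_pmf p" Y "-R" R
    by unfold_locales (use Y in \<open>auto intro!: AE_pmfI simp: abs_le_iff\<close>, force)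
  have "ennreal (measure_pmf.expectation p (\<lambda>x. exp (l * (Y x - ?m)))) = (\<integral>\<^sup>+ x. ennreal (exp (l * (Y x - ?m))) \<partial>p)"
    by (rule nn_integral_eq_integral[symmetric]) (auto intro: integrable_measure_pmf_finite fin)
  also have "\<dots> \<le> ennreal (exp (l\<^sup>2 * (R - (-R))\<^sup>2 / 8))"
    by (rule Hoeffdings_lemma_nn_integral[OF l])
  finally have "measure_pmf.expectation p (\<lambda>x. exp (l * (Y x - ?m))) \<le> exp (l\<^sup>2 * R\<^sup>2 / 2)"
    by (simp add: power_mult_distrib mult.commute)
  then have "measure_pmf.prob (Pi_pmf {..<n} d (\<lambda>_. p)) {z. (\<Sum>i<n. l * (Y (z i) - ?m)) \<ge> real n * (l * a)}
     \<le> exp (real n * (l\<^sup>2 * R\<^sup>2 / 2) - real n * (l * a))"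
    by (rule chernoff_Pi_pmf[OF fin])
  also have "real n * (l\<^sup>2 * R\<^sup>2 / 2) - real n * (l * a) = - (real n * a\<^sup>2 / (2 * R\<^sup>2))"
    using R by (simp add: l_def field_simps power2_eq_square)
  also have "{z. (\<Sum>i<n. l * (Y (z i) - ?m)) \<ge> real n * (l * a)} = {z. (\<Sum>i<n. Y (z i)) \<ge> real n * (?m + a)}"
  proof -
    have "(\<Sum>i<n. l * (Y (z i) - ?m)) = l * ((\<Sum>i<n. Y (z i)) - real n * ?m)" for z
      by (simp only: sum_distrib_left[symmetric] sum_subtractf) simp
    then have "real n * (l * a) \<le> (\<Sum>i<n. l * (Y (z i) - ?m)) \<longleftrightarrow>
        l * (real n * a) \<le> l * ((\<Sum>i<n. Y (z i)) - real n * ?m)" for z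
      by (simp only: mult.left_commute)
    then show ?thesis unfolding mult_le_cancel_left_pos[OF l] by (simp add: algebra_simps)
  qed
  finally show ?thesis .
qed

text \<open>A modulus above \<open>a\<close> forces the real or the imaginary part to deviate by at
  least \<open>a / 2\<close>, so four one-sided real tails cover the event.\<close>

lemma complex_hoeffding_Pi_pmf:
  fixes Y :: "'a \<Rightarrow> complex"
  assumes fin: "finite (set_pmf p)" and Y: "\<And>x. x \<in> set_pmf p \<Longrightarrow> cmod (Y x) \<le> R"
    and R: "R > 0" and a: "a > 0" and n: "n > 0"
  shows "measure_pmf.prob (Pi_pmf {..<n} d (\<lambda>_. p))
      {z. cmod (measure_pmf.expectation p Y - (\<Sum>i<n. Y (z i)) / of_nat n) > a} \<le> 4 * exp (- (real n * a\<^sup>2 / (8 * R\<^sup>2)))"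
proof -
  let ?P = "Pi_pmf {..<n} d (\<lambda>_. p)" and ?m = "measure_pmf.expectation p Y"
  let ?E = "\<lambda>f. {z. (\<Sum>i<n. f (Y (z i))) \<ge> real n * (f ?m + a / 2)}"
  have int: "integrable p Y" by (rule integrable_measure_pmf_finite[OF fin])
  \<comment> \<open>The four tails are treated alike: each of \<open>Re\<close>, \<open>Im\<close>
    and their negatives is bounded linear, hence commutes with the expectation, and does not exceed
    the modulus.\<close>
  have tail: "measure_pmf.prob ?P (?E f) \<le> exp (- (real n * a\<^sup>2 / (8 * R\<^sup>2)))"
    if f: "bounded_linear f" "\<And>v. \<bar>f v\<bar> \<le> cmod v" for f :: "complex \<Rightarrow> real"
  proof -
    have "f ?m = measure_pmf.expectation p (\<lambda>x. f (Y x))"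
      using integral_bounded_linear[OF f(1) int] by simp
    moreover have "measure_pmf.prob ?P {z. (\<Sum>i<n. f (Y (z i))) \<ge> real n * (measure_pmf.expectation p (\<lambda>x. f (Y x)) + a / 2)}
       \<le> exp (- (real n * (a / 2)\<^sup>2 / (2 * R\<^sup>2)))"
      by (rule hoeffding_Pi_pmf[OF fin]) (use R a Y f(2) order_trans in \<open>auto, blast\<close>)
    ultimately show ?thesis by (simp add: power_divide)
  qed
  have sub: "{z. cmod (?m - (\<Sum>i<n. Y (z i)) / of_nat n) > a} \<subseteq>
      (?E Re \<union> ?E (\<lambda>v. - Re v)) \<union> (?E Im \<union> ?E (\<lambda>v. - Im v))"
  proof
    fix z assume "z \<in> {z. cmod (?m - (\<Sum>i<n. Y (z i)) / of_nat n) > a}"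
    then have "\<bar>Re ?m - (\<Sum>i<n. Re (Y (z i))) / real n\<bar> + \<bar>Im ?m - (\<Sum>i<n. Im (Y (z i))) / real n\<bar> > a"
      using cmod_le[of "?m - (\<Sum>i<n. Y (z i)) / of_nat n"] by simp
    then consider "\<bar>Re ?m - (\<Sum>i<n. Re (Y (z i))) / real n\<bar> \<ge> a / 2" | "\<bar>Im ?m - (\<Sum>i<n. Im (Y (z i))) / real n\<bar> \<ge> a / 2"
      by linarith
    then show "z \<in> (?E Re \<union> ?E (\<lambda>v. - Re v)) \<union> (?E Im \<union> ?E (\<lambda>v. - Im v))"
      by cases (use n in \<open>auto simp: abs_real_def sum_negf field_simps split: if_splits\<close>)
  qed
  have "measure_pmf.prob ?P {z. cmod (?m - (\<Sum>i<n. Y (z i)) / of_nat n) > a} \<le>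
     measure_pmf.prob ?P ((?E Re \<union> ?E (\<lambda>v. - Re v)) \<union> (?E Im \<union> ?E (\<lambda>v. - Im v)))"
    by (rule measure_pmf.finite_measure_mono[OF sub]) auto
  also have "\<dots> \<le> (measure_pmf.prob ?P (?E Re) + measure_pmf.prob ?P (?E (\<lambda>v. - Re v))) +
     (measure_pmf.prob ?P (?E Im) + measure_pmf.prob ?P (?E (\<lambda>v. - Im v)))"
    by (intro order_trans[OF measure_Un_le] add_mono
        measure_Un_le) auto
  also have "\<dots> \<le> (exp (- (real n * a\<^sup>2 / (8 * R\<^sup>2))) + exp (- (real n * a\<^sup>2 / (8 * R\<^sup>2)))) + 
     (exp (- (real n * a\<^sup>2 / (8 * R\<^sup>2))) + exp (- (real n * a\<^sup>2 / (8 * R\<^sup>2))))"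
    by (intro add_mono tail bounded_linear_Re bounded_linear_Im bounded_linear_minus)
       (auto simp: abs_Re_le_cmod abs_Im_le_cmod)
  finally show ?thesis by simp
qed

text \<open>Maurey's method: the expected weight of the badly approximated coordinates is at most
  the right-hand side, so some sample does at least as well. As a small weight of bad coordinates is
  tolerated, no union bound over \<open>J\<close> is paid and \<open>n\<close> need not grow with
  its size.\<close>

lemma empirical_approximation:
  fixes Y :: "'j \<Rightarrow> 'a \<Rightarrow> complex" and w :: "'j \<Rightarrow> real"
  assumes fin: "finite (set_pmf p)" and J: "finite J" and w: "\<And>j. j \<in> J \<Longrightarrow> w j \<ge> 0"
    and Y: "\<And>j x. j \<in> J \<Longrightarrow> x \<in> set_pmf p \<Longrightarrow> cmod (Y j x) \<le> R"
    and R: "R > 0" and a: "a > 0" and n: "n > 0"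
  shows "\<exists>z\<in>PiE_dflt {..<n} d (\<lambda>_. set_pmf p).
     (\<Sum>j\<in>J. w j * of_bool (cmod (measure_pmf.expectation p (Y j) - (\<Sum>i<n. Y j (z i)) / of_nat n) > a))
      \<le> (\<Sum>j\<in>J. w j) * (4 * exp (- (real n * a\<^sup>2 / (8 * R\<^sup>2))))"
proof (rule ccontr)
  let ?P = "Pi_pmf {..<n} d (\<lambda>_. p)"
  let ?b = "4 * exp (- (real n * a\<^sup>2 / (8 * R\<^sup>2)))"
  let ?B = "\<lambda>j. {z. cmod (measure_pmf.expectation p (Y j) - (\<Sum>i<n. Y j (z i)) / of_nat n) > a}"
  let ?W = "\<lambda>z. \<Sum>j\<in>J. w j * indicator (?B j) z"
  have set: "set_pmf ?P = PiE_dflt {..<n} d (\<lambda>_. set_pmf p)" by (simp add: set_Pi_pmf o_def)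
  have fin': "finite (set_pmf ?P)"
    by (simp add: set_Pi_pmf fin finite_PiE_dflt)
  assume "\<not> ?thesis"
  then have gt: "?W z > (\<Sum>j\<in>J. w j) * ?b" if "z \<in> set_pmf ?P" for z
    using that unfolding set by (auto simp: indicator_def not_le of_bool_def)
  \<comment> \<open>A strict inequality at every point of a finite support passes to the
    expectation; linearity and the tail bound for each coordinate then contradict it.\<close>
  have "(\<Sum>j\<in>J. w j) * ?b < measure_pmf.expectation ?P ?W"
  proof -
    have "measure_pmf.expectation ?P (\<lambda>z. ?W z - (\<Sum>j\<in>J. w j) * ?b) > 0"
      by (subst integral_measure_pmf_real[OF fin'])
         (use gt in \<open>auto intro!: sum_pos fin' set_pmf_not_empty mult_pos_pos simp: pmf_positive\<close>)
    then show ?thesis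
      by (subst (asm) Bochner_Integration.integral_diff)
         (auto intro: integrable_measure_pmf_finite fin')
  qed
  also have "measure_pmf.expectation ?P ?W = (\<Sum>j\<in>J. w j * measure_pmf.prob ?P (?B j))"
    by (subst Bochner_Integration.integral_sum) (auto intro!: integrable_measure_pmf_finite[OF fin'])
  also have "\<dots> \<le> (\<Sum>j\<in>J. w j * ?b)"
    by (intro sum_mono mult_left_mono complex_hoeffding_Pi_pmf[OF fin] Y R a n w) auto
  finally show False by (simp add: sum_distrib_right)
qed

subsection \<open>Dyadic slabs\<close>

text \<open>Truncating at \<open>b\<close> and \<open>2 * b\<close>, instead of cutting
  \<open>z\<^sup>2\<close> off by an indicator, keeps the slab Lipschitz in
  \<open>z\<close>.\<close>

definition slab :: "real \<Rightarrow> real \<Rightarrow> real" where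
  "slab b z = (min (2 * b) z)\<^sup>2 - (min b z)\<^sup>2"

lemma slab_bounds:
  assumes "b > 0" "z \<ge> 0"
  shows "0 \<le> slab b z" "slab b z \<le> 3 * b\<^sup>2"
proof -
  have "(min b z)\<^sup>2 \<le> (min (2 * b) z)\<^sup>2" by (rule power_mono) (use assms in auto)
  then show "0 \<le> slab b z" by (simp add: slab_def)
  show "slab b z \<le> 3 * b\<^sup>2"
  proof (cases "z \<le> b")
    case False
    then have "(min (2 * b) z)\<^sup>2 \<le> (2 * b)\<^sup>2" by (intro power_mono) (use assms in auto)
    with False show ?thesis by (simp add: slab_def min_def power_mult_distrib split: if_splits)
  qed (use assms in \<open>simp add: slab_def\<close>)
qed

lemma slab_eq_0: "b > 0 \<Longrightarrow> z \<le> b \<Longrightarrow> slab b z = 0"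
  by (simp add: slab_def)

lemma slab_eq_top: "b > 0 \<Longrightarrow> 2 * b \<le> z \<Longrightarrow> slab b z = 3 * b\<^sup>2"
  by (simp add: slab_def power_mult_distrib)

text \<open>Up to a constant the slab is the square of \<open>z\<close> clamped to
  \<open>[b, 2 * b]\<close>. Clamping is a contraction, and the sum of two clamped values is at most
  \<open>4 * b\<close>.\<close>

lemma slab_lipschitz:
  assumes b: "b > 0"
  shows "\<bar>slab b z - slab b w\<bar> \<le> 4 * b * \<bar>z - w\<bar>"
proof -
  define c where "c = (\<lambda>z. max b (min (2 * b) z))"
  have slab: "slab b z = (c z)\<^sup>2 - b\<^sup>2" for z
    using b by (auto simp: slab_def c_def min_def max_def)
  have "\<bar>slab b z - slab b w\<bar> = (c z + c w) * \<bar>c z - c w\<bar>"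
  proof -
    have "slab b z - slab b w = (c z + c w) * (c z - c w)"
      by (simp add: slab power2_eq_square algebra_simps)
    moreover have "c z + c w \<ge> 0" using b by (simp add: c_def)
    ultimately show ?thesis by (simp add: abs_mult)
  qed
  also have "\<dots> \<le> (4 * b) * \<bar>z - w\<bar>"
    by (rule mult_mono) (use b in \<open>auto simp: c_def min_def max_def\<close>)
  finally show ?thesis .
qed

text \<open>
  An approximation at scale \<open>b\<close> is charged to the slab two scales below, so that the errors of
  all scales telescope as well.
\<close>

lemma slab_perturb:
  assumes b: "b > 0" and z: "z \<ge> 0" and \<eta>: "\<eta> \<le> 1 / 2" and zw: "\<bar>z - w\<bar> \<le> \<eta> * b"
  shows "\<bar>slab b z - slab b w\<bar> \<le> 22 * \<eta> * slab (b / 4) z"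
\<comment> \<open>Below \<open>b / 2\<close> both \<open>z\<close> and \<open>w\<close> stay below
  \<open>b\<close>, and both slabs vanish. From \<open>b / 2\<close> on, the slab at
  \<open>b / 4\<close> has its full value \<open>3 * (b / 4)\<^sup>2\<close>.\<close>
proof (cases "z < b / 2")
  case True
  have "\<eta> * b \<le> b / 2" using \<eta> b mult_right_mono[of \<eta> "1 / 2" b] by simp
  moreover have "\<eta> \<ge> 0" using zw b by (meson abs_ge_zero order_trans zero_le_mult_iff linorder_not_le order_less_imp_le)
  moreover from calculation(1) have "w \<le> b" using True zw by linarith
  ultimately show ?thesis
    using True b z slab_bounds(1)[of "b / 4" z] by (simp add: slab_eq_0)
next
  case False
  have "\<eta> \<ge> 0" using zw b by (meson abs_ge_zero order_trans zero_le_mult_iff linorder_not_le order_less_imp_le)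
  have "\<bar>slab b z - slab b w\<bar> \<le> 4 * b * (\<eta> * b)"
    by (rule order_trans[OF slab_lipschitz[OF b]]) (use b zw in \<open>auto intro!: mult_left_mono\<close>)
  \<comment> \<open>The factor \<open>22\<close> suffices because
    \<open>22 * 3 / 16 \<ge> 4\<close>.\<close>
  also have "\<dots> \<le> 22 * \<eta> * (3 * (b / 4)\<^sup>2)"
    using \<open>\<eta> \<ge> 0\<close> by (simp add: power2_eq_square mult_right_mono)
  also have "\<dots> = 22 * \<eta> * slab (b / 4) z"
    using False b by (simp add: slab_eq_top)
  finally show ?thesis .
qed

lemma sum_slab:
  assumes "K > 0"
  shows "(\<Sum>i=1..t. slab (K / 2 ^ i) z) = (min K z)\<^sup>2 - (min (K / 2 ^ t) z)\<^sup>2"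
  by (induction t) (simp_all add: slab_def)

section \<open>Empirical means of slabs\<close>

text \<open>With \<open>r = id\<close> and \<open>n = N\<close> this is the mean over all indices,
  so that the sampled and the full average share one notation.\<close>

definition emean :: "nat \<Rightarrow> (nat \<Rightarrow> 'a) \<Rightarrow> ('a \<Rightarrow> real) \<Rightarrow> real" where
  "emean n r h = (\<Sum>i<n. h (r i)) / real n"

lemma emean_mono: "(\<And>i. i < n \<Longrightarrow> h (r i) \<le> h' (r i)) \<Longrightarrow> emean n r h \<le> emean n r h'"
  unfolding emean_def by (intro divide_right_mono sum_mono) auto

lemma emean_add: "emean n r (\<lambda>x. h x + h' x) = emean n r h + emean n r h'"
  by (simp add: emean_def sum.distrib add_divide_distrib)

lemma emean_diff: "emean n r (\<lambda>x. h x - h' x) = emean n r h - emean n r h'"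
  by (simp add: emean_def sum_subtractf diff_divide_distrib)

lemma emean_cmult: "emean n r (\<lambda>x. c * h x) = c * emean n r h"
  by (simp add: emean_def sum_distrib_left)

lemma emean_sum: "emean n r (\<lambda>x. \<Sum>k\<in>S. h k x) = (\<Sum>k\<in>S. emean n r (h k))"
  unfolding emean_def by (subst sum.swap) (simp add: sum_divide_distrib)

lemma abs_emean_le: "\<bar>emean n r h\<bar> \<le> emean n r (\<lambda>x. \<bar>h x\<bar>)"
  unfolding emean_def by (simp add: divide_right_mono sum_abs)

lemma emean_nonneg: "(\<And>i. i < n \<Longrightarrow> 0 \<le> h (r i)) \<Longrightarrow> 0 \<le> emean n r h"
  unfolding emean_def by (intro divide_nonneg_nonneg sum_nonneg) auto

lemma emean_le_const:
  assumes "n > 0" "\<And>i. i < n \<Longrightarrow> h (r i) \<le> c"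
  shows "emean n r h \<le> c"
proof -
  have "(\<Sum>i<n. h (r i)) \<le> real n * c"
    using sum_bounded_above[of "{..<n}" "\<lambda>i. h (r i)" c] assms by simp
  then show ?thesis using assms(1) by (simp add: emean_def field_simps)
qed

text \<open>Pointwise, an index with \<open>F\<close> and \<open>G\<close> within
  \<open>\<eta> * b\<close> is charged to the slab at \<open>b / 4\<close>; at any other index two
  values in \<open>[0, 3 * b\<^sup>2]\<close> differ by at most
  \<open>3 * b\<^sup>2\<close>.\<close>

lemma emean_slab_approx:
  assumes b: "b > 0" and \<eta>: "0 \<le> \<eta>" "\<eta> \<le> 1 / 2"
    and F: "\<And>i. i < n \<Longrightarrow> F (r i) \<ge> 0" and G: "\<And>i. i < n \<Longrightarrow> G (r i) \<ge> 0"
  shows "\<bar>emean n r (\<lambda>x. slab b (F x)) - emean n r (\<lambda>x. slab b (G x))\<bar>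
    \<le> 22 * \<eta> * emean n r (\<lambda>x. slab (b / 4) (F x)) + 3 * b\<^sup>2 * emean n r (\<lambda>x. of_bool (\<bar>F x - G x\<bar> > \<eta> * b))"
proof -
  have "\<bar>emean n r (\<lambda>x. slab b (F x)) - emean n r (\<lambda>x. slab b (G x))\<bar>
     \<le> emean n r (\<lambda>x. \<bar>slab b (F x) - slab b (G x)\<bar>)"
    unfolding emean_diff[symmetric] by (rule abs_emean_le)
  also have "\<dots> \<le> emean n r (\<lambda>x. 22 * \<eta> * slab (b / 4) (F x) + 3 * b\<^sup>2 * of_bool (\<bar>F x - G x\<bar> > \<eta> * b))"
  proof (rule emean_mono)
    fix i assume i: "i < n"
    have nn: "0 \<le> 22 * \<eta> * slab (b / 4) (F (r i))"
      using \<eta> b slab_bounds(1)[of "b / 4" "F (r i)"] F[OF i] by simp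
    show "\<bar>slab b (F (r i)) - slab b (G (r i))\<bar>
        \<le> 22 * \<eta> * slab (b / 4) (F (r i)) + 3 * b\<^sup>2 * of_bool (\<bar>F (r i) - G (r i)\<bar> > \<eta> * b)"
    proof (cases "\<bar>F (r i) - G (r i)\<bar> > \<eta> * b")
      case True
      then show ?thesis
        using nn slab_bounds[OF b F[OF i]] slab_bounds[OF b G[OF i]] by simp
    next
      case False
      then show ?thesis using slab_perturb[OF b F[OF i] \<eta>(2)] by simp
    qed
  qed
  finally show ?thesis by (simp add: emean_add emean_cmult)
qed

text \<open>The deterministic core. At each scale one passes from \<open>F\<close> to
  \<open>G\<close> along \<open>r\<close>, from \<open>r\<close> to \<open>s\<close> for
  \<open>G\<close>, and back to \<open>F\<close> along \<open>s\<close>; then the scales are summed.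
  The function \<open>G\<close> may differ from scale to scale.\<close>

lemma emean_square_from_levels:
  assumes K: "K > 0" and \<eta>: "0 \<le> \<eta>" "\<eta> \<le> 1 / 2" and e: "0 \<le> e" "e \<le> 1" and p: "0 \<le> p"
    and nm: "n > 0" "m > 0"
    and Fr: "\<And>i. i < n \<Longrightarrow> 0 \<le> F (r i) \<and> F (r i) \<le> K"
    and Fs: "\<And>i. i < m \<Longrightarrow> 0 \<le> F (s i) \<and> F (s i) \<le> K"
    and lev: "\<And>i. i \<in> {1..t} \<Longrightarrow> \<exists>G. (\<forall>x. 0 \<le> G x) \<and>
        emean n r (\<lambda>x. of_bool (\<bar>F x - G x\<bar> > \<eta> * (K / 2 ^ i))) + emean m s (\<lambda>x. of_bool (\<bar>F x - G x\<bar> > \<eta> * (K / 2 ^ i))) \<le> p \<and>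
        \<bar>emean n r (\<lambda>x. slab (K / 2 ^ i) (G x)) - emean m s (\<lambda>x. slab (K / 2 ^ i) (G x))\<bar>
          \<le> e * emean m s (\<lambda>x. slab (K / 2 ^ i) (G x)) + \<alpha>"
  defines "A \<equiv> emean n r (\<lambda>x. (F x)\<^sup>2)" and "B \<equiv> emean m s (\<lambda>x. (F x)\<^sup>2)"
  shows "\<bar>A - B\<bar> \<le> 44 * \<eta> * (A + B) + e * B + 6 * K\<^sup>2 * real t * p + real t * \<alpha> + K\<^sup>2 / 4 ^ t"
proof -
  define S where "S = (\<lambda>i. emean n r (\<lambda>x. slab (K / 2 ^ i) (F x)))"
  define T where "T = (\<lambda>i. emean m s (\<lambda>x. slab (K / 2 ^ i) (F x)))"
  \<comment> \<open>\<open>U\<close> and \<open>V\<close> are the slabs at a quarter of the current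
    height, which receive the approximation errors.\<close>
  define U where "U = (\<lambda>i. emean n r (\<lambda>x. slab (K / 4 / 2 ^ i) (F x)))"
  define V where "V = (\<lambda>i. emean m s (\<lambda>x. slab (K / 4 / 2 ^ i) (F x)))"
  have level: "\<bar>S i - T i\<bar> \<le> 44 * \<eta> * (U i + V i) + e * T i + (6 * K\<^sup>2 * p + \<alpha>)" if i: "i \<in> {1..t}" for i
  proof -
    let ?b = "K / 2 ^ i"
    have b: "?b > 0" using K by simp
    have b2: "?b\<^sup>2 \<le> K\<^sup>2"
      by (rule power_mono) (use K in \<open>auto simp: field_simps\<close>)
    obtain G where G: "\<And>x. 0 \<le> G x"
      and bad: "emean n r (\<lambda>x. of_bool (\<bar>F x - G x\<bar> > \<eta> * ?b)) + emean m s (\<lambda>x. of_bool (\<bar>F x - G x\<bar> > \<eta> * ?b)) \<le> p"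
      and conc: "\<bar>emean n r (\<lambda>x. slab ?b (G x)) - emean m s (\<lambda>x. slab ?b (G x))\<bar> \<le> e * emean m s (\<lambda>x. slab ?b (G x)) + \<alpha>"
      using lev[OF i] by blast
    define SG where "SG = emean n r (\<lambda>x. slab ?b (G x))"
    define TG where "TG = emean m s (\<lambda>x. slab ?b (G x))"
    define bn where "bn = emean n r (\<lambda>x. of_bool (\<bar>F x - G x\<bar> > \<eta> * ?b))"
    define bm where "bm = emean m s (\<lambda>x. of_bool (\<bar>F x - G x\<bar> > \<eta> * ?b))"
    have DS: "\<bar>S i - SG\<bar> \<le> 22 * \<eta> * U i + 3 * ?b\<^sup>2 * bn"
      using emean_slab_approx[OF b \<eta>, of n F r G] Fr G by (simp add: S_def SG_def U_def bn_def mult.commute)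
    have DT: "\<bar>T i - TG\<bar> \<le> 22 * \<eta> * V i + 3 * ?b\<^sup>2 * bm"
      using emean_slab_approx[OF b \<eta>, of m F s G] Fs G by (simp add: T_def TG_def V_def bm_def mult.commute)
    have "3 * ?b\<^sup>2 * bn + 3 * ?b\<^sup>2 * bm = 3 * (?b\<^sup>2 * (bn + bm))" by (simp add: algebra_simps)
    also have "\<dots> \<le> 3 * (K\<^sup>2 * p)"
      using bad b2 p by (intro mult_left_mono mult_mono) (auto simp: bn_def bm_def intro!: add_nonneg_nonneg emean_nonneg)
    finally have D: "\<bar>S i - SG\<bar> + \<bar>T i - TG\<bar> \<le> 22 * \<eta> * (U i + V i) + 3 * (K\<^sup>2 * p)"
      using DS DT by (simp add: algebra_simps)
    define dS where "dS = \<bar>S i - SG\<bar>"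
    define dT where "dT = \<bar>T i - TG\<bar>"
    have d: "dS \<ge> 0" "dT \<ge> 0" "TG \<le> T i + dT" by (auto simp: dS_def dT_def)
    have tri: "\<bar>S i - T i\<bar> \<le> dS + \<bar>SG - TG\<bar> + dT" by (simp add: dS_def dT_def)
    \<comment> \<open>The relative error is known for \<open>G\<close> and has to be expressed by
      \<open>F\<close>. As \<open>e \<le> 1\<close>, this costs \<open>dT\<close> a second time,
      hence the factor 2 that leads from \<open>22\<close> and \<open>3\<close> to \<open>44\<close>
      and \<open>6\<close>.\<close>
    have "e * TG \<le> e * T i + e * dT"
      using mult_left_mono[OF d(3) e(1)] by (simp add: algebra_simps)
    moreover have "e * dT \<le> dT"
      using e d by (simp add: mult_left_le_one_le)
    ultimately have "\<bar>S i - T i\<bar> \<le> 2 * (dS + dT) + e * T i + \<alpha>"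
      using conc tri d unfolding SG_def[symmetric] TG_def[symmetric] distrib_left by linarith
    then show ?thesis using D unfolding dS_def dT_def by (simp add: algebra_simps)
  qed
  \<comment> \<open>Since \<open>F \<le> K\<close> at the visited indices, truncation at
    \<open>K\<close> changes nothing, and only the part below height \<open>K / 2 ^ t\<close> is
    missing from the sum.\<close>
  have tel: "(\<Sum>i=1..t. emean l u (\<lambda>x. slab (K / 2 ^ i) (F x))) =
      emean l u (\<lambda>x. (F x)\<^sup>2) - emean l u (\<lambda>x. (min (K / 2 ^ t) (F x))\<^sup>2)"
    if "\<And>i. i < l \<Longrightarrow> 0 \<le> F (u i) \<and> F (u i) \<le> K" for l u
  proof -
    have "(\<Sum>i=1..t. emean l u (\<lambda>x. slab (K / 2 ^ i) (F x))) =
       emean l u (\<lambda>x. (min K (F x))\<^sup>2 - (min (K / 2 ^ t) (F x))\<^sup>2)"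
      by (simp only: emean_sum[symmetric] sum_slab[OF K])
    also have "\<dots> = emean l u (\<lambda>x. (F x)\<^sup>2 - (min (K / 2 ^ t) (F x))\<^sup>2)"
      unfolding emean_def using that by (intro arg_cong2[where f = "(/)"] sum.cong) auto
    finally show ?thesis by (simp add: emean_diff)
  qed
  have tail: "0 \<le> emean l u (\<lambda>x. (min (K / 2 ^ t) (F x))\<^sup>2)"
    "emean l u (\<lambda>x. (min (K / 2 ^ t) (F x))\<^sup>2) \<le> K\<^sup>2 / 4 ^ t"
    if "l > 0" "\<And>i. i < l \<Longrightarrow> 0 \<le> F (u i) \<and> F (u i) \<le> K" for l u
  proof -
    show "0 \<le> emean l u (\<lambda>x. (min (K / 2 ^ t) (F x))\<^sup>2)" by (rule emean_nonneg) auto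
    have "(K / 2 ^ t)\<^sup>2 = K\<^sup>2 / 4 ^ t"
      by (simp add: power_divide power_mult[symmetric] mult.commute[of _ 2]) (simp add: power_mult)
    then show "emean l u (\<lambda>x. (min (K / 2 ^ t) (F x))\<^sup>2) \<le> K\<^sup>2 / 4 ^ t"
      using that K by (intro emean_le_const that(1)) (auto intro!: power_mono simp flip: \<open>(K / 2 ^ t)\<^sup>2 = _\<close>)
  qed
  have low: "(\<Sum>i=1..t. emean l u (\<lambda>x. slab (K / 4 / 2 ^ i) (F x))) \<le> emean l u (\<lambda>x. (F x)\<^sup>2)"
    if "\<And>i. i < l \<Longrightarrow> 0 \<le> F (u i) \<and> F (u i) \<le> K" for l u
  proof -
    have K4: "K / 4 > 0" using K by simp
    have "(\<Sum>i=1..t. emean l u (\<lambda>x. slab (K / 4 / 2 ^ i) (F x))) =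
       emean l u (\<lambda>x. (min (K / 4) (F x))\<^sup>2 - (min (K / 4 / 2 ^ t) (F x))\<^sup>2)"
      by (simp only: emean_sum[symmetric] sum_slab[OF K4])
    also have "\<dots> \<le> emean l u (\<lambda>x. (F x)\<^sup>2)"
    proof (rule emean_mono)
      fix i assume "i < l"
      then have "(min (K / 4) (F (u i)))\<^sup>2 \<le> (F (u i))\<^sup>2"
        using that K by (intro power_mono) auto
      then show "(min (K / 4) (F (u i)))\<^sup>2 - (min (K / 4 / 2 ^ t) (F (u i)))\<^sup>2 \<le> (F (u i))\<^sup>2"
        using zero_le_power2[of "min (K / 4 / 2 ^ t) (F (u i))"] by linarith
    qed
    finally show ?thesis .
  qed
  have "\<bar>(\<Sum>i=1..t. S i) - (\<Sum>i=1..t. T i)\<bar> \<le> (\<Sum>i=1..t. \<bar>S i - T i\<bar>)"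
    unfolding sum_subtractf[symmetric] by (rule sum_abs)
  also have "\<dots> \<le> (\<Sum>i=1..t. 44 * \<eta> * (U i + V i) + e * T i + (6 * K\<^sup>2 * p + \<alpha>))"
    by (rule sum_mono) (rule level)
  also have "\<dots> = 44 * \<eta> * ((\<Sum>i=1..t. U i) + (\<Sum>i=1..t. V i)) + e * (\<Sum>i=1..t. T i) + real t * (6 * K\<^sup>2 * p + \<alpha>)"
    by (simp add: sum.distrib sum_distrib_left[symmetric])
  also have "\<dots> \<le> 44 * \<eta> * (A + B) + e * B + real t * (6 * K\<^sup>2 * p + \<alpha>)"
  proof -
    have "(\<Sum>i=1..t. U i) \<le> A" "(\<Sum>i=1..t. V i) \<le> B"
      unfolding U_def V_def A_def B_def using low[OF Fr] low[OF Fs] by auto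
    moreover have "(\<Sum>i=1..t. T i) \<le> B"
      using tel[OF Fs] tail(1)[OF nm(2) Fs] by (simp add: T_def B_def)
    ultimately show ?thesis using \<eta> e by (intro add_mono mult_left_mono) auto
  qed
  finally have dev: "\<bar>(\<Sum>i=1..t. S i) - (\<Sum>i=1..t. T i)\<bar>
      \<le> 44 * \<eta> * (A + B) + e * B + real t * (6 * K\<^sup>2 * p + \<alpha>)" .
  \<comment> \<open>Both remainders lie between 0 and \<open>K\<^sup>2 / 4 ^ t\<close>, so their
    difference costs this amount only once.\<close>
  define tn where "tn = emean n r (\<lambda>x. (min (K / 2 ^ t) (F x))\<^sup>2)"
  define tm where "tm = emean m s (\<lambda>x. (min (K / 2 ^ t) (F x))\<^sup>2)"
  have "(\<Sum>i=1..t. S i) = A - tn" unfolding S_def A_def tn_def by (rule tel) (rule Fr)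
  moreover have "(\<Sum>i=1..t. T i) = B - tm" unfolding T_def B_def tm_def by (rule tel) (rule Fs)
  moreover have "0 \<le> tn" "tn \<le> K\<^sup>2 / 4 ^ t" unfolding tn_def using tail nm(1) Fr by blast+
  moreover have "0 \<le> tm" "tm \<le> K\<^sup>2 / 4 ^ t" unfolding tm_def using tail nm(2) Fs by blast+
  moreover have "real t * (6 * K\<^sup>2 * p + \<alpha>) = 6 * K\<^sup>2 * real t * p + real t * \<alpha>"
    by (simp add: algebra_simps)
  ultimately show ?thesis using dev by linarith
qed

subsection \<open>Empirical approximation on the \<open>\<ell>\<^sub>1\<close> ball\<close>

text \<open>The pair \<open>(l, c)\<close> encodes the vector whose only nonzero entry is
  \<open>c\<close>, at position \<open>l\<close>.\<close>

definition atoms :: "nat \<Rightarrow> (nat \<times> complex) set" where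
  "atoms N = {..<N} \<times> {1, -1, \<i>, -\<i>}"

lemma finite_atoms [simp]: "finite (atoms N)"
  by (simp add: atoms_def)

lemma card_atoms: "card (atoms N) = 4 * N"
  by (simp add: atoms_def card_cartesian_product complex_eq_iff card_insert_if)

lemma sum_atoms:
  "(\<Sum>v\<in>atoms N. f v) = (\<Sum>l<N. f (l, 1) + f (l, -1) + f (l, \<i>) + f (l, -\<i>))"
  for f :: "nat \<times> complex \<Rightarrow> 'b::comm_monoid_add"
  unfolding atoms_def sum.cartesian_product[symmetric, of "\<lambda>a b. f (a, b)", simplified]
  by (intro sum.cong refl) (simp add: complex_eq_iff add.assoc)

text \<open>
  Every point of the \<open>\<ell>\<^sub>1\<close> unit ball is the mean of a law on the vectors
  \<open>2 c e\<^sub>l\<close> with \<open>c \<in> {1, -1, \<i>, -\<i>}\<close>. The mass that is left over is spread evenly,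
  where it cancels.
\<close>

lemma l1_ball_barycentre:
  fixes x :: "nat \<Rightarrow> complex"
  assumes N: "N > 0" and x: "(\<Sum>l<N. cmod (x l)) \<le> 1"
  obtains p where "set_pmf p \<subseteq> atoms N"
    "\<And>\<Phi>. measure_pmf.expectation p (\<lambda>v. 2 * \<Phi> (fst v) * snd v) = (\<Sum>l<N. \<Phi> l * x l)"
proof -
  \<comment> \<open>\<open>W\<close> is at most 2, because each of the two parts is bounded by the
    modulus; this is why the atoms carry the factor 2.\<close>
  define W where "W = (\<Sum>l<N. \<bar>Re (x l)\<bar> + \<bar>Im (x l)\<bar>)"
  \<comment> \<open>An atom \<open>(l, c)\<close> gets half the positive part of the component of
    \<open>x l\<close> in direction \<open>c\<close>, and half of \<open>u\<close>. The choice of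
    \<open>u\<close> makes the total \<open>W / 2 + 2 * N * u\<close> equal to 1.\<close>
  define u where "u = (2 - W) / (4 * real N)"
  define f where "f = (\<lambda>v. if v \<in> atoms N then (max 0 (Re (x (fst v) * cnj (snd v))) + u) / 2 else 0)"
  have "W \<le> (\<Sum>l<N. cmod (x l) + cmod (x l))"
    unfolding W_def by (intro sum_mono add_mono abs_Re_le_cmod abs_Im_le_cmod)
  also have "\<dots> \<le> 2" using x by (simp only: sum.distrib)
  finally have u0: "u \<ge> 0" by (simp add: u_def)
  have f0: "f v \<ge> 0" for v using u0 by (simp add: f_def)
  have mem: "l < N \<Longrightarrow> (l, c) \<in> atoms N" if "c \<in> {1, -1, \<i>, -\<i>}" for l c
    using that by (simp add: atoms_def)
  have "(\<Sum>v\<in>atoms N. f v) = (\<Sum>l<N. (\<bar>Re (x l)\<bar> + \<bar>Im (x l)\<bar>) / 2 + 2 * u)"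
    unfolding sum_atoms by (intro sum.cong refl) (auto simp: f_def mem max_def field_simps)
  also have "\<dots> = W / 2 + real N * (2 * u)"
    by (subst sum.distrib) (simp add: W_def flip: sum_divide_distrib)
  also have "\<dots> = 1" using N by (simp add: u_def field_simps)
  finally have f1: "(\<Sum>v\<in>atoms N. f v) = 1" .
  have "(\<integral>\<^sup>+ v. ennreal (f v) \<partial>count_space UNIV) = (\<Sum>v\<in>atoms N. ennreal (f v))"
    by (rule nn_integral_count_space') (auto simp: f_def)
  also have "\<dots> = 1" using f0 f1 by (simp add: sum_ennreal)
  finally have nn: "(\<integral>\<^sup>+ v. ennreal (f v) \<partial>count_space UNIV) = 1" .
  define p where "p = embed_pmf f"
  have pmf: "pmf p v = f v" for v unfolding p_def by (rule pmf_embed_pmf[OF f0 nn])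
  have set: "set_pmf p \<subseteq> atoms N" by (auto simp: set_pmf_iff pmf f_def split: if_splits)
  show thesis
  proof (rule that[OF set])
    fix \<Phi>
    have "measure_pmf.expectation p (\<lambda>v. 2 * \<Phi> (fst v) * snd v) = (\<Sum>v\<in>atoms N. f v *\<^sub>R (2 * \<Phi> (fst v) * snd v))"
      by (subst integral_measure_pmf[of "atoms N"]) (use set in \<open>auto simp: pmf\<close>)
    also have "\<dots> = (\<Sum>l<N. \<Phi> l * x l)"
      unfolding sum_atoms
    proof (intro sum.cong refl)
      fix l assume "l \<in> {..<N}"
      then have *: "f (l, 1) = (max 0 (Re (x l)) + u) / 2" "f (l, -1) = (max 0 (- Re (x l)) + u) / 2"
        "f (l, \<i>) = (max 0 (Im (x l)) + u) / 2" "f (l, -\<i>) = (max 0 (- Im (x l)) + u) / 2"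
        by (auto simp: f_def mem)
      have "f (l, 1) *\<^sub>R (2 * \<Phi> l * 1) + f (l, -1) *\<^sub>R (2 * \<Phi> l * -1) + f (l, \<i>) *\<^sub>R (2 * \<Phi> l * \<i>) + f (l, -\<i>) *\<^sub>R (2 * \<Phi> l * -\<i>)
        = 2 * \<Phi> l * (of_real (f (l, 1) - f (l, -1)) + \<i> * of_real (f (l, \<i>) - f (l, -\<i>)))"
        by (simp add: scaleR_conv_of_real algebra_simps)
      \<comment> \<open>The shares \<open>u\<close> of opposite atoms cancel, and the difference of
        the positive parts of a number and its negative is the number.\<close>
      also have "f (l, 1) - f (l, -1) = Re (x l) / 2" by (simp add: * max_def field_simps)
      also have "f (l, \<i>) - f (l, -\<i>) = Im (x l) / 2" by (simp add: * max_def field_simps)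
      also have "2 * \<Phi> l * (of_real (Re (x l) / 2) + \<i> * of_real (Im (x l) / 2)) = \<Phi> l * x l"
        by (subst (3) complex_eq) (simp add: algebra_simps)
      finally show "f (l, 1) *\<^sub>R (2 * \<Phi> (fst (l, 1::complex)) * snd (l, 1::complex)) + f (l, -1) *\<^sub>R (2 * \<Phi> (fst (l, -1::complex)) * snd (l, -1::complex))
         + f (l, \<i>) *\<^sub>R (2 * \<Phi> (fst (l, \<i>)) * snd (l, \<i>)) + f (l, -\<i>) *\<^sub>R (2 * \<Phi> (fst (l, -\<i>)) * snd (l, -\<i>)) = \<Phi> l * x l"
        by simp
    qed
    finally show "measure_pmf.expectation p (\<lambda>v. 2 * \<Phi> (fst v) * snd v) = (\<Sum>l<N. \<Phi> l * x l)" .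
  qed
qed

text \<open>The fixed value \<open>(0, 0)\<close> outside \<open>{..<n}\<close> makes each
  \<open>n\<close>-tuple of atoms occur exactly once.\<close>

definition net :: "nat \<Rightarrow> nat \<Rightarrow> (nat \<Rightarrow> nat \<times> complex) set" where
  "net N n = PiE_dflt {..<n} (0, 0) (\<lambda>_. atoms N)"

text \<open>The modulus of row \<open>j\<close> of \<open>\<Phi>\<close> applied to the average of
  the \<open>n\<close> vectors \<open>2 c e_l\<close> listed by \<open>z\<close>.\<close>

definition net_fun :: "(nat \<Rightarrow> nat \<Rightarrow> complex) \<Rightarrow> nat \<Rightarrow> (nat \<Rightarrow> nat \<times> complex) \<Rightarrow> nat \<Rightarrow> real" where
  "net_fun \<Phi> n z j = cmod ((\<Sum>i<n. 2 * \<Phi> j (fst (z i)) * snd (z i)) / of_nat n)"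

lemma finite_net: "finite (net N n)"
  by (simp add: net_def finite_PiE_dflt)

lemma card_net: "card (net N n) = (4 * N) ^ n"
  by (simp add: net_def card_PiE_dflt card_atoms)

text \<open>Maurey's method for the sampled indices and all indices at once. The choice of
  \<open>z\<close> depends on \<open>r\<close> and \<open>x\<close>, but the net does not, which is
  what a later union bound requires.\<close>

lemma net_approximation:
  fixes \<Phi> :: "nat \<Rightarrow> nat \<Rightarrow> complex" and x :: "nat \<Rightarrow> complex"
  assumes N: "N > 0" and q: "q > 0" and n: "n > 0" and a: "a > 0" and K: "K > 0"
    and \<Phi>: "\<And>j l. j < N \<Longrightarrow> l < N \<Longrightarrow> cmod (\<Phi> j l) \<le> K"
    and r: "\<And>i. i < q \<Longrightarrow> r i < N"
    and x: "(\<Sum>l<N. cmod (x l)) \<le> 1"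
  defines "F \<equiv> \<lambda>j. cmod (\<Sum>l<N. \<Phi> j l * x l)"
  shows "\<exists>z\<in>net N n. emean q r (\<lambda>j. of_bool (\<bar>F j - net_fun \<Phi> n z j\<bar> > a)) +
      emean N id (\<lambda>j. of_bool (\<bar>F j - net_fun \<Phi> n z j\<bar> > a)) \<le> 8 * exp (- (real n * a\<^sup>2 / (32 * K\<^sup>2)))"
proof -
  obtain p where p: "set_pmf p \<subseteq> atoms N"
    and mean: "\<And>\<Phi>. measure_pmf.expectation p (\<lambda>v. 2 * \<Phi> (fst v) * snd v) = (\<Sum>l<N. \<Phi> l * x l)"
    using l1_ball_barycentre[OF N x] by blast
  \<comment> \<open>A disjoint sum keeps the two families apart. Each has total weight 1, so the
    bound \<open>4 * exp\<close> per coordinate becomes \<open>8 * exp\<close>.\<close>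
  define J :: "(nat + nat) set" where "J = {..<q} <+> {..<N}"
  define w where "w = case_sum (\<lambda>_::nat. 1 / real q) (\<lambda>_::nat. 1 / real N)"
  define Y where "Y = (\<lambda>j v. 2 * \<Phi> (case_sum r id j) (fst v) * snd v)"
  let ?D = "\<lambda>z j. cmod (measure_pmf.expectation p (Y j) - (\<Sum>i<n. Y j (z i)) / of_nat n)"
  have "finite (set_pmf p)" using p finite_subset finite_atoms by blast
  then have "\<exists>z\<in>PiE_dflt {..<n} (0, 0) (\<lambda>_. set_pmf p).
     (\<Sum>j\<in>J. w j * of_bool (?D z j > a)) \<le> (\<Sum>j\<in>J. w j) * (4 * exp (- (real n * a\<^sup>2 / (8 * (2 * K)\<^sup>2))))"
  proof (rule empirical_approximation)
    fix j v assume j: "j \<in> J" and v: "v \<in> set_pmf p"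
    have "case_sum r id j < N" using j r by (auto simp: J_def)
    moreover have "fst v < N" "cmod (snd v) = 1" using v p by (auto simp: atoms_def)
    ultimately show "cmod (Y j v) \<le> 2 * K" using \<Phi> by (simp add: Y_def norm_mult)
  qed (use K a n in \<open>auto simp: J_def w_def\<close>)
  then obtain z where z: "z \<in> PiE_dflt {..<n} (0, 0) (\<lambda>_. set_pmf p)"
    and le: "(\<Sum>j\<in>J. w j * of_bool (?D z j > a)) \<le> (\<Sum>j\<in>J. w j) * (4 * exp (- (real n * a\<^sup>2 / (8 * (2 * K)\<^sup>2))))"
    by blast
  have zn: "z \<in> net N n" using z p by (fastforce simp: net_def PiE_dflt_def)
  \<comment> \<open>\<open>F\<close> is the modulus of an expectation and \<open>net_fun\<close>
    that of the sample mean, so the reverse triangle inequality applies.\<close>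
  have D: "\<bar>F (case_sum r id j) - net_fun \<Phi> n z (case_sum r id j)\<bar> \<le> ?D z j" for j
    unfolding F_def net_fun_def Y_def mean by (rule norm_triangle_ineq3)
  have "emean q r (\<lambda>j. of_bool (\<bar>F j - net_fun \<Phi> n z j\<bar> > a)) + emean N id (\<lambda>j. of_bool (\<bar>F j - net_fun \<Phi> n z j\<bar> > a))
    = (\<Sum>j\<in>J. w j * of_bool (\<bar>F (case_sum r id j) - net_fun \<Phi> n z (case_sum r id j)\<bar> > a))"
    unfolding J_def by (subst sum.Plus) (simp_all add: w_def emean_def sum_divide_distrib del: sum_of_bool_eq)
  also have "\<dots> \<le> (\<Sum>j\<in>J. w j * of_bool (?D z j > a))"
    using D by (intro sum_mono mult_left_mono) (auto simp: of_bool_def w_def J_def intro: less_le_trans)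
  also note le
  also have "(\<Sum>j\<in>J. w j) = 2"
    unfolding J_def by (subst sum.Plus) (use N q in \<open>simp_all add: w_def\<close>)
  also have "2 * (4 * exp (- (real n * a\<^sup>2 / (8 * (2 * K)\<^sup>2)))) = 8 * exp (- (real n * a\<^sup>2 / (32 * K\<^sup>2)))"
    by (simp add: power_mult_distrib)
  finally show ?thesis using zn by (rule bexI)
qed

section \<open>Union bound over the nets of all scales\<close>

lemma uniform_relative_deviation:
  fixes h :: "'b \<Rightarrow> nat \<Rightarrow> real"
  assumes Z: "finite Z" and N: "N > 0" and q: "q > 0" and e: "0 < e" "e \<le> 1" and B: "B > 0"
    and h: "\<And>z j. z \<in> Z \<Longrightarrow> j < N \<Longrightarrow> 0 \<le> h z j \<and> h z j \<le> B"
  shows "measure_pmf.prob (Pi_pmf {..<q} d (\<lambda>_. pmf_of_set {..<N}))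
     {r. \<exists>z\<in>Z. \<bar>emean q r (h z) - emean N id (h z)\<bar> > e * emean N id (h z) + \<alpha>}
     \<le> real (card Z) * (2 * exp (- (e * real q * \<alpha> / B)))"
proof -
  let ?P = "Pi_pmf {..<q} d (\<lambda>_. pmf_of_set {..<N})"
  let ?E = "\<lambda>z. {r. \<bar>emean q r (h z) - emean N id (h z)\<bar> > e * emean N id (h z) + \<alpha>}"
  have ne: "{..<N} \<noteq> {}" using N by auto
  have mean: "measure_pmf.expectation (pmf_of_set {..<N}) (h z) = emean N id (h z)" for z
    by (subst integral_pmf_of_set) (use N in \<open>auto simp: emean_def\<close>)
  have "measure_pmf.prob ?P (\<Union>z\<in>Z. ?E z) \<le> (\<Sum>z\<in>Z. measure_pmf.prob ?P (?E z))"
    by (rule measure_pmf.finite_measure_subadditive_finite[OF Z]) auto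
  also have "\<dots> \<le> (\<Sum>z\<in>Z. 2 * exp (- (e * real q * \<alpha> / B)))"
  proof (rule sum_mono)
    fix z assume z: "z \<in> Z"
    show "measure_pmf.prob ?P (?E z) \<le> 2 * exp (- (e * real q * \<alpha> / B))"
      unfolding mean[symmetric] emean_def[of q]
      by (rule relative_chernoff_Pi_pmf) (use h[OF z] B e q ne in \<open>auto simp: set_pmf_of_set\<close>)
  qed
  also have "(\<Union>z\<in>Z. ?E z) = {r. \<exists>z\<in>Z. \<bar>emean q r (h z) - emean N id (h z)\<bar> > e * emean N id (h z) + \<alpha>}"
    by auto
  finally show ?thesis by simp
qed

text \<open>The bad events involve only the nets, which are fixed before \<open>r\<close> is drawn,
  so finitely many of them are excluded. Outside them the estimate holds for the whole l1 ball,
  since every \<open>x\<close> finds approximants in the nets.\<close>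

lemma subsampling_l1_ball:
  fixes \<Phi> :: "nat \<Rightarrow> nat \<Rightarrow> complex" and s :: "nat \<Rightarrow> nat"
  assumes N: "N > 0" and q: "q > 0" and K: "K > 0" and e: "0 < e" "e \<le> 1" and \<eta>: "0 < \<eta>" "\<eta> \<le> 1 / 2"
    and p: "0 \<le> p"
    and \<Phi>: "\<And>j l. j < N \<Longrightarrow> l < N \<Longrightarrow> cmod (\<Phi> j l) \<le> K"
    and s: "\<And>i. i \<in> {1..t} \<Longrightarrow> s i > 0 \<and> 8 * exp (- (real (s i) * \<eta>\<^sup>2 / (32 * 4 ^ i))) \<le> p"
  defines "F \<equiv> \<lambda>x j. cmod (\<Sum>l<N. \<Phi> j l * x l)"
  defines "A \<equiv> \<lambda>r x. emean q r (\<lambda>j. (F x j)\<^sup>2)" and "B \<equiv> \<lambda>x. emean N id (\<lambda>j. (F x j)\<^sup>2)"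
  shows "measure_pmf.prob (Pi_pmf {..<q} 0 (\<lambda>_. pmf_of_set {..<N}))
     {r. (\<forall>i<q. r i < N) \<and> (\<forall>x. (\<Sum>l<N. cmod (x l)) \<le> 1 \<longrightarrow> \<bar>A r x - B x\<bar> \<le>
        44 * \<eta> * (A r x + B x) + e * B x + 6 * K\<^sup>2 * real t * p + real t * \<alpha> + K\<^sup>2 / 4 ^ t)}
     \<ge> 1 - (\<Sum>i=1..t. real ((4 * N) ^ s i) * (2 * exp (- (e * real q * \<alpha> / (3 * (K / 2 ^ i)\<^sup>2)))))"
proof -
  let ?P = "Pi_pmf {..<q} 0 (\<lambda>_. pmf_of_set {..<N})"
  define h where "h = (\<lambda>i z j. slab (K / 2 ^ i) (net_fun \<Phi> (s i) z j))"
  let ?E = "\<lambda>i. {r. \<exists>z\<in>net N (s i). \<bar>emean q r (h i z) - emean N id (h i z)\<bar> > e * emean N id (h i z) + \<alpha>}"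
  let ?G = "{r. (\<forall>i<q. r i < N) \<and> (\<forall>x. (\<Sum>l<N. cmod (x l)) \<le> 1 \<longrightarrow> \<bar>A r x - B x\<bar> \<le>
        44 * \<eta> * (A r x + B x) + e * B x + 6 * K\<^sup>2 * real t * p + real t * \<alpha> + K\<^sup>2 / 4 ^ t)}"
  have ne: "{..<N} \<noteq> {}" using N by auto
  have F: "0 \<le> F x j \<and> F x j \<le> K" if x: "(\<Sum>l<N. cmod (x l)) \<le> 1" and j: "j < N" for x j
  proof -
    have "F x j \<le> (\<Sum>l<N. cmod (\<Phi> j l * x l))" unfolding F_def by (rule norm_sum)
    also have "\<dots> \<le> (\<Sum>l<N. K * cmod (x l))"
      unfolding norm_mult by (intro sum_mono mult_right_mono \<Phi> j) auto
    also have "\<dots> \<le> K" using x K by (simp add: sum_distrib_left[symmetric])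
    finally show ?thesis by (simp add: F_def)
  qed
  have bad: "measure_pmf.prob ?P (\<Union>i\<in>{1..t}. ?E i) \<le>
      (\<Sum>i=1..t. real ((4 * N) ^ s i) * (2 * exp (- (e * real q * \<alpha> / (3 * (K / 2 ^ i)\<^sup>2)))))"
  proof -
    have "measure_pmf.prob ?P (\<Union>i\<in>{1..t}. ?E i) \<le> (\<Sum>i=1..t. measure_pmf.prob ?P (?E i))"
      by (rule measure_pmf.finite_measure_subadditive_finite) auto
    also have "\<dots> \<le> (\<Sum>i=1..t. real ((4 * N) ^ s i) * (2 * exp (- (e * real q * \<alpha> / (3 * (K / 2 ^ i)\<^sup>2)))))"
    proof (rule sum_mono)
      fix i
      have b: "K / 2 ^ i > 0" using K by simp
      show "measure_pmf.prob ?P (?E i) \<le> real ((4 * N) ^ s i) * (2 * exp (- (e * real q * \<alpha> / (3 * (K / 2 ^ i)\<^sup>2))))"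
        unfolding card_net[symmetric]
        by (rule uniform_relative_deviation[OF finite_net N q e])
           (use b slab_bounds[OF b] in \<open>auto simp: h_def net_fun_def\<close>)
    qed
    finally show ?thesis .
  qed
  have good: "r \<in> ?G" if r: "r \<in> set_pmf ?P" and nb: "r \<notin> (\<Union>i\<in>{1..t}. ?E i)" for r
  proof -
    have rN: "r i < N" if "i < q" for i
      using r that N ne by (auto simp: set_Pi_pmf PiE_dflt_def set_pmf_of_set)
    have "\<bar>A r x - B x\<bar> \<le> 44 * \<eta> * (A r x + B x) + e * B x + 6 * K\<^sup>2 * real t * p + real t * \<alpha> + K\<^sup>2 / 4 ^ t"
      if x: "(\<Sum>l<N. cmod (x l)) \<le> 1" for x
      unfolding A_def B_def
    proof (rule emean_square_from_levels)
      fix i assume i: "i \<in> {1..t}"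
      have a: "\<eta> * (K / 2 ^ i) > 0" using \<eta> K by simp
      have "\<exists>z\<in>net N (s i). emean q r (\<lambda>j. of_bool (\<bar>F x j - net_fun \<Phi> (s i) z j\<bar> > \<eta> * (K / 2 ^ i))) +
          emean N id (\<lambda>j. of_bool (\<bar>F x j - net_fun \<Phi> (s i) z j\<bar> > \<eta> * (K / 2 ^ i)))
         \<le> 8 * exp (- (real (s i) * (\<eta> * (K / 2 ^ i))\<^sup>2 / (32 * K\<^sup>2)))"
        unfolding F_def by (rule net_approximation[OF N q _ a K \<Phi> rN x]) (use s[OF i] in auto)
      then obtain z where z: "z \<in> net N (s i)"
        and le: "emean q r (\<lambda>j. of_bool (\<bar>F x j - net_fun \<Phi> (s i) z j\<bar> > \<eta> * (K / 2 ^ i))) +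
          emean N id (\<lambda>j. of_bool (\<bar>F x j - net_fun \<Phi> (s i) z j\<bar> > \<eta> * (K / 2 ^ i)))
         \<le> 8 * exp (- (real (s i) * (\<eta> * (K / 2 ^ i))\<^sup>2 / (32 * K\<^sup>2)))"
        by (rule bexE)
      \<comment> \<open>The tolerance at scale \<open>i\<close> is proportional to the bound
        \<open>K\<close> on the entries; \<open>K\<close> cancels and leaves the factor
        \<open>4 ^ i\<close> in the required sample size.\<close>
      have "(2 ^ i)\<^sup>2 = (4::real) ^ i" by (simp add: power2_eq_square flip: power_mult_distrib)
      then have "real (s i) * (\<eta> * (K / 2 ^ i))\<^sup>2 / (32 * K\<^sup>2) = real (s i) * \<eta>\<^sup>2 / (32 * 4 ^ i)"
        using K by (simp add: power_mult_distrib power_divide)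
      with le s[OF i] have le': "emean q r (\<lambda>j. of_bool (\<bar>F x j - net_fun \<Phi> (s i) z j\<bar> > \<eta> * (K / 2 ^ i))) +
      emean N id (\<lambda>j. of_bool (\<bar>F x j - net_fun \<Phi> (s i) z j\<bar> > \<eta> * (K / 2 ^ i))) \<le> p" by simp
      have "\<bar>emean q r (h i z) - emean N id (h i z)\<bar> \<le> e * emean N id (h i z) + \<alpha>"
        using nb i z by (auto simp: not_less)
      then show "\<exists>G. (\<forall>x. 0 \<le> G x) \<and>
        emean q r (\<lambda>j. of_bool (\<bar>F x j - G j\<bar> > \<eta> * (K / 2 ^ i))) + emean N id (\<lambda>j. of_bool (\<bar>F x j - G j\<bar> > \<eta> * (K / 2 ^ i))) \<le> p \<and>
        \<bar>emean q r (\<lambda>j. slab (K / 2 ^ i) (G j)) - emean N id (\<lambda>j. slab (K / 2 ^ i) (G j))\<bar>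
          \<le> e * emean N id (\<lambda>j. slab (K / 2 ^ i) (G j)) + \<alpha>"
        using le' by (intro exI[of _ "net_fun \<Phi> (s i) z"]) (auto simp: h_def net_fun_def)
    qed (use K \<eta> e p q N F[OF x] rN in auto)
    then show ?thesis using rN by blast
  qed
  have "1 - measure_pmf.prob ?P (\<Union>i\<in>{1..t}. ?E i) = measure_pmf.prob ?P (UNIV - (\<Union>i\<in>{1..t}. ?E i))"
    using measure_pmf.prob_compl[of "\<Union>i\<in>{1..t}. ?E i" ?P] by simp
  also have "\<dots> \<le> measure_pmf.prob ?P ?G"
    \<comment> \<open>The inclusion is available on the support only, where the sampled indices are
      below \<open>N\<close>.\<close>
    by (rule measure_pmf.finite_measure_mono_AE) (use good in \<open>auto intro!: AE_pmfI\<close>)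
  finally show ?thesis using bad by linarith
qed

subsection \<open>Choice of the parameters\<close>

text \<open>One factor \<open>ln k\<close> comes from the number \<open>t\<close> of scales, the
  other from \<open>ln (8 / p)\<close> with \<open>1 / p\<close> polynomial in \<open>k\<close>; the
  factor \<open>ln N\<close> comes from the logarithm of the size of a net.\<close>

lemma sampling_parameters:
  fixes K e \<eta> :: real
  assumes K: "K \<ge> 1" and e: "0 < e" "e \<le> 1" and \<eta>: "0 < \<eta>" "\<eta> \<le> 1"
  obtains C c :: real where "C > 0" "c > 0"
    "\<And>N k :: nat. 2 \<le> k \<Longrightarrow> k \<le> N \<Longrightarrow> \<exists>q t s p \<alpha>. q > 0 \<and>
        real q \<le> C * real k * (ln (real k))\<^sup>2 * ln (real N) \<and> 0 \<le> p \<and>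
        (\<forall>i\<in>{1..t}. s i > 0 \<and> 8 * exp (- (real (s i) * \<eta>\<^sup>2 / (32 * 4 ^ i))) \<le> p) \<and>
        6 * K\<^sup>2 * real t * p + real t * \<alpha> + K\<^sup>2 / 4 ^ t \<le> e / real k \<and>
        (\<Sum>i=1..t. real ((4 * N) ^ s i) * (2 * exp (- (e * real q * \<alpha> / (3 * (K / 2 ^ i)\<^sup>2))))) \<le> c / real N"
proof -
  \<comment> \<open>Each of the three error terms gets the share \<open>e / (3 k)\<close>; this dictates \<open>t\<close>, \<open>\<alpha>\<close> and \<open>p\<close>.
     The factor \<open>D\<close> makes the Chernoff exponent exceed the logarithm of the size of the net
     by \<open>2 ln N\<close>.\<close>
  define c0 where "c0 = 3 * K\<^sup>2 / e"
  define ct where "ct = 2 * ln c0 + 3"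
  define cL where "cL = 2 * ln (144 * K\<^sup>2 * ct / e) + 2"
  define D where "D = 909 * ct * K\<^sup>2 * cL / (e\<^sup>2 * \<eta>\<^sup>2)"
  have K2: "K\<^sup>2 \<ge> 1" using K by simp
  have c0: "c0 \<ge> 3" using K2 e by (simp add: c0_def field_simps)
  have ct: "ct \<ge> 3" using c0 by (simp add: ct_def)
  have "144 * K\<^sup>2 * ct / e \<ge> 1"
  proof -
    have "1 * 1 \<le> K\<^sup>2 * ct" by (intro mult_mono) (use K2 ct in auto)
    then show ?thesis using e by (simp add: field_simps)
  qed
  then have cL: "cL \<ge> 2" by (simp add: cL_def)
  have D: "D \<ge> 4"
  proof -
    have "1 * 1 * 1 * 1 \<le> ct * K\<^sup>2 * cL" using K2 ct cL by (intro mult_mono) auto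
    moreover have "e\<^sup>2 * \<eta>\<^sup>2 \<le> 1 * 1" using e \<eta> by (intro mult_mono power_le_one) auto
    ultimately have "4 * (e\<^sup>2 * \<eta>\<^sup>2) \<le> 909 * (ct * K\<^sup>2 * cL)" by linarith
    then show ?thesis using e \<eta> by (simp add: D_def pos_le_divide_eq mult.assoc)
  qed
  have ln2: "ln (2::real) > 1 / 2" using ln2_ge_two_thirds by simp
  show thesis
  proof (rule that[of "2 * D" "2 * ct"])
    fix N k :: nat assume k: "2 \<le> k" and kN: "k \<le> N"
    define lk where "lk = ln (real k)"
    define lN where "lN = ln (real N)"
    \<comment> \<open>As \<open>k \<ge> 2\<close>, one has \<open>1 < 2 * lk\<close>, so additive
      constants can be absorbed into multiples of \<open>lk\<close>, below for both \<open>t\<close>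
      and \<open>L\<close>.\<close>
    have "ln 2 \<le> lk" using k by (simp add: lk_def)
    then have lk: "lk > 1 / 2" using ln2 by linarith
    have lkN: "lk \<le> lN" using k kN by (simp add: lk_def lN_def)
    have lkk: "lk \<le> real k" using ln_bound[of "real k"] k by (simp add: lk_def)
    \<comment> \<open>The least \<open>t\<close> with \<open>c0 * k \<le> 4 ^ t\<close>, which is
      what \<open>K\<^sup>2 / 4 ^ t \<le> e / (3 * k)\<close> asks for.\<close>
    define t where "t = nat \<lceil>ln (c0 * real k) / ln 4\<rceil>"
    have c0k: "c0 * real k \<ge> 3 * 2" using c0 k by (intro mult_mono) auto
    have ln4: "ln (4::real) \<ge> 1" using ln2 ln_realpow[of "2::real" 2] by simp
    have t_ge: "ln (c0 * real k) / ln 4 \<le> real t" unfolding t_def by linarith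
    have "ln (c0 * real k) > 0" using c0k by (intro ln_gt_zero) auto
    then have pos: "ln (c0 * real k) / ln 4 > 0" using ln4 by simp
    have t0: "t > 0" using t_ge pos by (cases t) auto
    have "real t \<le> ln (c0 * real k) / ln 4 + 1" using pos unfolding t_def by linarith
    also have "ln (c0 * real k) / ln 4 \<le> ln (c0 * real k)"
      using \<open>ln (c0 * real k) > 0\<close> ln4 by (simp add: divide_le_eq mult_le_cancel_left1)
    also have "ln (c0 * real k) = ln c0 + lk" using c0 k by (simp add: ln_mult lk_def)
    also have "ln c0 + lk + 1 \<le> ct * lk"
    proof -
      have "ln c0 * 1 \<le> ln c0 * (2 * lk)" by (intro mult_left_mono) (use c0 lk in auto)
      then show ?thesis using lk by (simp add: ct_def algebra_simps)
    qed
    finally have t_le: "real t \<le> ct * lk" by simp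
    have "c0 * real k \<le> 4 ^ t"
    proof -
      have "ln (c0 * real k) \<le> real t * ln 4" using t_ge ln4 by (simp add: pos_divide_le_eq)
      also have "\<dots> = ln (4 ^ t)" by (simp add: ln_realpow)
      finally show ?thesis using c0k by simp
    qed
    then have tail: "K\<^sup>2 / 4 ^ t \<le> e / (3 * real k)"
      using K e k by (simp add: c0_def field_simps)
    define \<alpha> where "\<alpha> = e / (3 * real k * real t)"
    define p where "p = e / (18 * K\<^sup>2 * real t * real k)"
    \<comment> \<open>The exponent for which \<open>8 * exp (- L) = p\<close>.\<close>
    define L where "L = ln (8 / p)"
    have p0: "p > 0" using e K k t0 by (simp add: p_def)
    have p8: "8 / p = 144 * K\<^sup>2 * real t * real k / e" by (simp add: p_def)
    have L1: "L \<ge> 1"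
    proof -
      have "1 * 1 * 1 \<le> K\<^sup>2 * real t * real k" using K2 t0 k by (intro mult_mono) auto
      then have "3 * e \<le> 144 * (K\<^sup>2 * real t * real k)" using e by linarith
      then have "3 \<le> 8 / p" unfolding p8 using e by (simp add: pos_le_divide_eq mult.assoc)
      then have "exp 1 \<le> 8 / p" using exp_le by linarith
      then show ?thesis unfolding L_def using p0 by (subst ln_ge_iff) auto
    qed
    have L_le: "L \<le> cL * lk"
    proof -
      \<comment> \<open>Inside the logarithm the crude bound \<open>t \<le> ct * k\<close> is good
        enough: it makes \<open>8 / p\<close> at most a constant times
        \<open>k\<^sup>2\<close>.\<close>
      have "ct * lk \<le> ct * real k" using lkk ct by (intro mult_left_mono) auto
      then have "real t \<le> ct * real k" using t_le by linarith
      then have "144 * K\<^sup>2 * real t * real k / e \<le> 144 * K\<^sup>2 * (ct * real k) * real k / e"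
        using e by (intro divide_right_mono mult_right_mono mult_left_mono) auto
      then have "L \<le> ln ((144 * K\<^sup>2 * ct / e) * (real k * real k))"
        unfolding L_def p8 using t0 k e K ct by (subst ln_le_cancel_iff) (auto simp: mult_ac)
      also have "\<dots> = ln (144 * K\<^sup>2 * ct / e) + 2 * lk"
        using k e K ct by (subst ln_mult) (auto simp: ln_mult lk_def)
      also have "\<dots> \<le> cL * lk"
      proof -
        have "ln (144 * K\<^sup>2 * ct / e) * 1 \<le> ln (144 * K\<^sup>2 * ct / e) * (2 * lk)"
          using \<open>144 * K\<^sup>2 * ct / e \<ge> 1\<close> lk by (intro mult_left_mono) auto
        then show ?thesis by (simp add: cL_def algebra_simps)
      qed
      finally show ?thesis .
    qed
    \<comment> \<open>Rounding up brings the exponent to at least \<open>L\<close>. It adds at most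
      1, and since \<open>4 ^ i * L / \<eta>\<^sup>2 \<ge> 1\<close> this only turns
      \<open>32\<close> into \<open>33\<close>.\<close>
    define s where "s = (\<lambda>i::nat. nat \<lceil>32 * (4 ^ i * L / \<eta>\<^sup>2)\<rceil>)"
    have s_ge: "32 * (4 ^ i * L / \<eta>\<^sup>2) \<le> real (s i)" for i unfolding s_def by linarith
    have \<eta>2: "0 < \<eta>\<^sup>2" "\<eta>\<^sup>2 \<le> 1" using \<eta> by (auto intro: power_le_one)
    have unit: "1 \<le> 4 ^ i * L / \<eta>\<^sup>2" for i
    proof -
      have "1 * 1 \<le> 4 ^ i * L" using L1 by (intro mult_mono) auto
      then show ?thesis using \<eta>2 by (simp add: pos_le_divide_eq)
    qed
    have s_le: "real (s i) \<le> 33 * (4 ^ i * L / \<eta>\<^sup>2)" for i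
    proof -
      have "real (nat \<lceil>32 * y\<rceil>) \<le> 33 * y" if "1 \<le> y" for y :: real using that by linarith
      then show ?thesis unfolding s_def using unit by blast
    qed
    have s0: "s i > 0" for i using s_ge[of i] unit[of i] by (cases "s i") auto
    have s_p: "8 * exp (- (real (s i) * \<eta>\<^sup>2 / (32 * 4 ^ i))) \<le> p" for i
    proof -
      have "L \<le> real (s i) * \<eta>\<^sup>2 / (32 * 4 ^ i)"
        using s_ge[of i] \<eta>2 by (simp add: field_simps)
      then have "8 * exp (- (real (s i) * \<eta>\<^sup>2 / (32 * 4 ^ i))) \<le> 8 * exp (- L)" by simp
      also have "\<dots> = p" unfolding L_def using p0 by (simp add: exp_minus)
      finally show ?thesis .
    qed
    \<comment> \<open>\<open>X\<close> samples suffice. Because \<open>X \<ge> 1\<close>, the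
      integer part of \<open>2 * X\<close> lies between \<open>X\<close> and \<open>2 * X\<close>,
      whence the constant \<open>2 * D\<close>.\<close>
    define X where "X = D * real k * lk\<^sup>2 * lN"
    define q where "q = nat \<lfloor>2 * X\<rfloor>"
    have X1: "X \<ge> 1"
    proof -
      have "4 * 2 * (1/2)\<^sup>2 * (1/2) \<le> D * real k * lk\<^sup>2 * lN"
        using D k lk lkN by (intro mult_mono power_mono) auto
      then show ?thesis by (simp add: X_def power2_eq_square)
    qed
    have q_le: "real q \<le> 2 * X" and q_ge: "X \<le> real q" using X1 unfolding q_def by linarith+
    have q0: "q > 0" using q_ge X1 by (cases q) auto
    have R: "6 * K\<^sup>2 * real t * p + real t * \<alpha> + K\<^sup>2 / 4 ^ t \<le> e / real k"
    proof -
      have "6 * K\<^sup>2 * real t * p = e / (3 * real k)" using K t0 k by (simp add: p_def field_simps)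
      moreover have "real t * \<alpha> = e / (3 * real k)" using t0 k by (simp add: \<alpha>_def field_simps)
      moreover have "e / real k = e / (3 * real k) + e / (3 * real k) + e / (3 * real k)"
        using k by (simp add: field_simps)
      ultimately show ?thesis using tail by linarith
    qed
    \<comment> \<open>The surplus \<open>2 * lN\<close> in the exponent leaves
      \<open>2 / N\<^sup>2\<close> per scale, and there are at most \<open>ct * N\<close>
      scales.\<close>
    have level: "real ((4 * N) ^ s i) * (2 * exp (- (e * real q * \<alpha> / (3 * (K / 2 ^ i)\<^sup>2)))) \<le> 2 / (real N)\<^sup>2" for i
    proof -
      have N2: "real N \<ge> 2" using k kN by simp
      have lN0: "lN > 0" using lk lkN by linarith
      have "ln (4 * real N) \<le> 3 * lN"
      proof -
        have "4 * real N \<le> real N ^ 3"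
          using mult_mono[of 4 "(real N)\<^sup>2" "real N" "real N"] power_mono[of 2 "real N" 2] N2
          by (simp add: power3_eq_cube power2_eq_square)
        then have "ln (4 * real N) \<le> ln (real N ^ 3)" using N2 by (subst ln_le_cancel_iff) auto
        then show ?thesis by (simp add: lN_def ln_realpow)
      qed
      \<comment> \<open>Here \<open>33 * 3 + 2 = 101\<close>, the last term using
        \<open>1 \<le> 4 ^ i * L / \<eta>\<^sup>2\<close>; the constant \<open>909\<close> in
        \<open>D\<close> is \<open>9 * 101\<close>, with the \<open>9\<close> from the Chernoff
        exponent.\<close>
      then have "real (s i) * ln (4 * real N) + 2 * lN \<le> 33 * (4 ^ i * L / \<eta>\<^sup>2) * (3 * lN) + 2 * (4 ^ i * L / \<eta>\<^sup>2) * lN"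
        using s_le[of i] unit[of i] lN0 N2 by (intro add_mono mult_mono) auto
      also have "\<dots> = 101 * 4 ^ i * lN / \<eta>\<^sup>2 * L" by (simp add: field_simps)
      also have "\<dots> \<le> 101 * 4 ^ i * lN / \<eta>\<^sup>2 * (cL * lk)"
        using L_le lN0 by (intro mult_left_mono) auto
      also have "\<dots> = e\<^sup>2 * X * 4 ^ i / (9 * real k * (ct * lk) * K\<^sup>2)"
        using K e \<eta> ct lk k by (simp add: X_def D_def field_simps power2_eq_square)
      also have "\<dots> \<le> e\<^sup>2 * real q * 4 ^ i / (9 * real k * real t * K\<^sup>2)"
        using q_ge t_le X1 t0 K k ct lk by (intro frac_le mult_mono) auto
      also have "\<dots> = e * real q * \<alpha> / (3 * (K / 2 ^ i)\<^sup>2)"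
      proof -
        have "(2 ^ i)\<^sup>2 = (4::real) ^ i" by (simp add: power2_eq_square flip: power_mult_distrib)
        then have "(K / 2 ^ i)\<^sup>2 = K\<^sup>2 / 4 ^ i" by (simp add: power_divide)
        then show ?thesis using K t0 k by (simp add: \<alpha>_def field_simps power2_eq_square)
      qed
      finally have exponent: "real (s i) * ln (4 * real N) + 2 * lN \<le> e * real q * \<alpha> / (3 * (K / 2 ^ i)\<^sup>2)" .
      have "real ((4 * N) ^ s i) = exp (real (s i) * ln (4 * real N))"
        using N2 by (simp add: exp_of_nat_mult)
      then have "real ((4 * N) ^ s i) * (2 * exp (- (e * real q * \<alpha> / (3 * (K / 2 ^ i)\<^sup>2))))
          = 2 * exp (real (s i) * ln (4 * real N) - e * real q * \<alpha> / (3 * (K / 2 ^ i)\<^sup>2))"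
        by (simp add: exp_diff exp_minus field_simps)
      also have "\<dots> \<le> 2 * exp (- (2 * lN))" using exponent by simp
      also have "exp (- (2 * lN)) = 1 / (real N)\<^sup>2"
        using N2 exp_of_nat_mult[of 2 lN] by (simp add: exp_minus lN_def inverse_eq_divide)
      finally show ?thesis by simp
    qed
    have "(\<Sum>i=1..t. real ((4 * N) ^ s i) * (2 * exp (- (e * real q * \<alpha> / (3 * (K / 2 ^ i)\<^sup>2))))) \<le> (\<Sum>i=1..t. 2 / (real N)\<^sup>2)"
      by (rule sum_mono) (rule level)
    also have "\<dots> = real t * 2 / (real N)\<^sup>2" by simp
    also have "\<dots> \<le> (ct * real N) * 2 / (real N)\<^sup>2"
    proof -
      have "ct * lk \<le> ct * real N" using lkk kN ct by (intro mult_left_mono) auto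
      then show ?thesis using t_le by (intro divide_right_mono mult_right_mono) auto
    qed
    also have "\<dots> = 2 * ct / real N" by (simp add: power2_eq_square)
    finally have sum: "(\<Sum>i=1..t. real ((4 * N) ^ s i) * (2 * exp (- (e * real q * \<alpha> / (3 * (K / 2 ^ i)\<^sup>2))))) \<le> 2 * ct / real N" .
    show "\<exists>q t s p \<alpha>. q > 0 \<and>
        real q \<le> 2 * D * real k * (ln (real k))\<^sup>2 * ln (real N) \<and> 0 \<le> p \<and>
        (\<forall>i\<in>{1..t}. s i > 0 \<and> 8 * exp (- (real (s i) * \<eta>\<^sup>2 / (32 * 4 ^ i))) \<le> p) \<and>
        6 * K\<^sup>2 * real t * p + real t * \<alpha> + K\<^sup>2 / 4 ^ t \<le> e / real k \<and>
        (\<Sum>i=1..t. real ((4 * N) ^ s i) * (2 * exp (- (e * real q * \<alpha> / (3 * (K / 2 ^ i)\<^sup>2))))) \<le> 2 * ct / real N"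
      using q0 q_le p0 s0 s_p R sum
      by (intro exI[of _ q] exI[of _ t] exI[of _ s] exI[of _ p] exI[of _ \<alpha>])
         (auto simp: X_def lk_def lN_def mult.assoc)
  qed (use D ct in auto)
qed

subsection \<open>Restricted isometry\<close>

lemma mult_mat_vec_index:
  assumes "A \<in> carrier_mat m n" "x \<in> carrier_vec n" "i < m"
  shows "(A *\<^sub>v x) $ i = (\<Sum>l<n. A $$ (i, l) * x $ l)"
  using assms by (auto simp: scalar_prod_def atLeast0LessThan intro!: sum.cong)

lemma sampled_mat_carrier: "M \<in> carrier_mat N N \<Longrightarrow> sampled_mat M q r \<in> carrier_mat q N"
  by (auto simp: sampled_mat_def intro!: carrier_matI)

text \<open>The scaling \<open>sqrt (N / q)\<close> is split: \<open>sqrt N\<close> goes into the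
  matrix entries, and \<open>1 / sqrt q\<close> turns the sum over the sampled rows into a
  mean.\<close>

lemma l2_norm_sampled_mat:
  assumes M: "M \<in> carrier_mat N N" and x: "x \<in> carrier_vec N" and r: "\<And>i. i < q \<Longrightarrow> r i < N"
  shows "(l2_norm (sampled_mat M q r *\<^sub>v x))\<^sup>2 =
    emean q r (\<lambda>j. (cmod (\<Sum>l<N. (complex_of_real (sqrt (real N)) * M $$ (j, l)) * x $ l))\<^sup>2)"
proof -
  let ?A = "sampled_mat M q r"
  have A: "?A \<in> carrier_mat q N" by (rule sampled_mat_carrier[OF M])
  have entry: "?A $$ (i, l) = complex_of_real (sqrt (real N / real q)) * M $$ (r i, l)"
    if "i < q" "l < N" for i l
    using that M r[OF that(1)] by (simp add: sampled_mat_def mat_of_rows_index)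
  have "(l2_norm (?A *\<^sub>v x))\<^sup>2 = (\<Sum>i<q. (cmod ((?A *\<^sub>v x) $ i))\<^sup>2)"
    using A by (simp add: l2_norm_def L2_set_def sum_nonneg)
  also have "\<dots> = (\<Sum>i<q. (cmod (\<Sum>l<N. (complex_of_real (sqrt (real N)) * M $$ (r i, l)) * x $ l))\<^sup>2 / real q)"
  proof (intro sum.cong refl)
    fix i assume i: "i \<in> {..<q}"
    have "(?A *\<^sub>v x) $ i = complex_of_real (1 / sqrt (real q)) * (\<Sum>l<N. (complex_of_real (sqrt (real N)) * M $$ (r i, l)) * x $ l)"
      using i by (subst mult_mat_vec_index[OF A x])
        (auto simp: entry real_sqrt_divide sum_distrib_left mult_ac intro!: sum.cong)
    then show "(cmod ((?A *\<^sub>v x) $ i))\<^sup>2 = (cmod (\<Sum>l<N. (complex_of_real (sqrt (real N)) * M $$ (r i, l)) * x $ l))\<^sup>2 / real q"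
      by (simp add: norm_mult norm_divide power_divide)
  qed
  finally show ?thesis by (simp add: emean_def sum_divide_distrib)
qed

lemma l2_norm_unitary:
  assumes M: "M \<in> carrier_mat N N" and U: "unitary_mat M" and x: "x \<in> carrier_vec N"
  shows "(l2_norm (M *\<^sub>v x))\<^sup>2 = (l2_norm x)\<^sup>2"
proof -
  have adj: "mat_adjoint M \<in> carrier_mat N N" using M by (auto simp: mat_adjoint_def intro!: carrier_matI)
  have adjM: "mat_adjoint M $$ (l, j) = cnj (M $$ (j, l))" if "l < N" "j < N" for l j
    using M that by (simp add: mat_adjoint_def mat_of_rows_index)
  have orth: "(\<Sum>j<N. cnj (M $$ (j, l)) * M $$ (j, l')) = (if l = l' then 1 else 0)" if l: "l < N" "l' < N" for l l'
  proof -
    have "mat_adjoint M * M = 1\<^sub>m N"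
      using U adj by (simp add: unitary_mat_def inverts_mat_def)
    then have "(mat_adjoint M * M) $$ (l, l') = (if l = l' then 1 else 0)" using l by simp
    then show ?thesis
      using M adj l by (simp add: scalar_prod_def atLeast0LessThan adjM)
  qed
  have sq: "complex_of_real ((l2_norm v)\<^sup>2) = (\<Sum>i<N. cnj (v $ i) * v $ i)" if "v \<in> carrier_vec N" for v
    using that by (simp add: l2_norm_def L2_set_def sum_nonneg complex_norm_square[symmetric] mult.commute)
  have Mx: "M *\<^sub>v x \<in> carrier_vec N" using M x by auto
  have "complex_of_real ((l2_norm (M *\<^sub>v x))\<^sup>2) = (\<Sum>j<N. (\<Sum>l<N. cnj (M $$ (j, l)) * cnj (x $ l)) * (\<Sum>l<N. M $$ (j, l) * x $ l))"
    unfolding sq[OF Mx] by (intro sum.cong refl) (simp add: mult_mat_vec_index[OF M x])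
  also have "\<dots> = (\<Sum>j<N. \<Sum>l<N. \<Sum>l'<N. cnj (x $ l) * x $ l' * (cnj (M $$ (j, l)) * M $$ (j, l')))"
    by (simp only: sum_product) (intro sum.cong refl, simp add: mult_ac)
  also have "\<dots> = (\<Sum>l<N. \<Sum>j<N. \<Sum>l'<N. cnj (x $ l) * x $ l' * (cnj (M $$ (j, l)) * M $$ (j, l')))"
    by (rule sum.swap)
  also have "\<dots> = (\<Sum>l<N. \<Sum>l'<N. \<Sum>j<N. cnj (x $ l) * x $ l' * (cnj (M $$ (j, l)) * M $$ (j, l')))"
    by (intro sum.cong refl sum.swap)
  also have "\<dots> = (\<Sum>l<N. \<Sum>l'<N. cnj (x $ l) * x $ l' * (if l = l' then 1 else 0))"
    unfolding sum_distrib_left[symmetric] by (intro sum.cong refl) (simp add: orth)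
  also have "\<dots> = (\<Sum>l<N. cnj (x $ l) * x $ l)"
    by (intro sum.cong refl) (simp add: if_distrib[of "\<lambda>t. _ * t"] cong: if_cong)
  also have "\<dots> = complex_of_real ((l2_norm x)\<^sup>2)" by (rule sq[OF x, symmetric])
  finally show ?thesis by (simp only: of_real_eq_iff)
qed

text \<open>Parseval's identity: the mean over all rows is the squared norm that the sampled mean
  has to reproduce.\<close>

lemma emean_unitary:
  assumes N: "N > 0" and M: "M \<in> carrier_mat N N" and U: "unitary_mat M" and x: "x \<in> carrier_vec N"
  shows "emean N id (\<lambda>j. (cmod (\<Sum>l<N. (complex_of_real (sqrt (real N)) * M $$ (j, l)) * x $ l))\<^sup>2) = (l2_norm x)\<^sup>2"
proof -
  have Mx: "dim_vec (M *\<^sub>v x) = N" using M by simp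
  have "(cmod (\<Sum>l<N. (complex_of_real (sqrt (real N)) * M $$ (j, l)) * x $ l))\<^sup>2 = real N * (cmod ((M *\<^sub>v x) $ j))\<^sup>2"
    if "j < N" for j
  proof -
    have "(\<Sum>l<N. (complex_of_real (sqrt (real N)) * M $$ (j, l)) * x $ l) = complex_of_real (sqrt (real N)) * (M *\<^sub>v x) $ j"
      using mult_mat_vec_index[OF M x that] by (simp add: sum_distrib_left mult.assoc)
    then show ?thesis by (simp add: norm_mult power_mult_distrib)
  qed
  then have "emean N id (\<lambda>j. (cmod (\<Sum>l<N. (complex_of_real (sqrt (real N)) * M $$ (j, l)) * x $ l))\<^sup>2)
     = (\<Sum>j<N. (cmod ((M *\<^sub>v x) $ j))\<^sup>2)"
    using N by (simp add: emean_def sum_distrib_left[symmetric])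
  also have "\<dots> = (l2_norm (M *\<^sub>v x))\<^sup>2" unfolding l2_norm_def L2_set_def Mx by (simp add: sum_nonneg)
  finally show ?thesis using l2_norm_unitary[OF M U x] by simp
qed

text \<open>Cauchy-Schwarz on the support.\<close>

lemma sparse_l1_le_l2:
  assumes y: "sparse_vec k y"
  shows "(\<Sum>l<dim_vec y. cmod (y $ l))\<^sup>2 \<le> real k * (l2_norm y)\<^sup>2"
proof -
  define T where "T = {i. i < dim_vec y \<and> y $ i \<noteq> 0}"
  have T: "finite T" "card T \<le> k" "T \<subseteq> {..<dim_vec y}" using y by (auto simp: T_def sparse_vec_def)
  have "(\<Sum>l<dim_vec y. cmod (y $ l)) = (\<Sum>l\<in>T. cmod (y $ l))"
    by (rule sum.mono_neutral_right) (auto simp: T_def)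
  then have "(\<Sum>l<dim_vec y. cmod (y $ l))\<^sup>2 \<le> (\<Sum>l\<in>T. (cmod (y $ l))\<^sup>2) * real (card T)"
    using sum_squared_le_sum_of_squares[of "\<lambda>l. cmod (y $ l)" T] by simp
  also have "\<dots> \<le> (l2_norm y)\<^sup>2 * real k"
  proof (rule mult_mono)
    have "(l2_norm y)\<^sup>2 = (\<Sum>l<dim_vec y. (cmod (y $ l))\<^sup>2)"
      by (simp add: l2_norm_def L2_set_def sum_nonneg)
    then show "(\<Sum>l\<in>T. (cmod (y $ l))\<^sup>2) \<le> (l2_norm y)\<^sup>2" using T by (simp add: sum_mono2)
  qed (use T in auto)
  finally show ?thesis by (simp add: mult.commute)
qed

lemma l2_norm_smult: "l2_norm (c \<cdot>\<^sub>v x) = cmod c * l2_norm x"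
  by (simp add: l2_norm_def L2_set_def norm_mult power_mult_distrib real_sqrt_mult
      flip: sum_distrib_left)

text \<open>By homogeneity a sparse vector may be scaled to l1 norm 1. Its squared Euclidean norm is
  then at least \<open>1 / k\<close>, so the additive error \<open>e / k\<close> becomes a relative
  one.\<close>

lemma restricted_isometry_from_l1_ball:
  assumes A: "A \<in> carrier_mat q N" and k: "k > 0" and e: "0 < e" "e \<le> 1 / 8" "8 * e \<le> \<epsilon>"
    and ball: "\<And>x. x \<in> carrier_vec N \<Longrightarrow> (\<Sum>l<N. cmod (x $ l)) \<le> 1 \<Longrightarrow>
      \<bar>(l2_norm (A *\<^sub>v x))\<^sup>2 - (l2_norm x)\<^sup>2\<bar> \<le> e * (l2_norm (A *\<^sub>v x))\<^sup>2 + 2 * e * (l2_norm x)\<^sup>2 + e / real k"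
  shows "restricted_isometry A k \<epsilon>"
  unfolding restricted_isometry_def
proof (intro ballI impI)
  fix y assume "y \<in> carrier_vec (dim_col A)" and sp: "sparse_vec k y"
  then have y: "y \<in> carrier_vec N" using A by simp
  define m where "m = (\<Sum>l<N. cmod (y $ l))"
  have m_sq: "m\<^sup>2 \<le> real k * (l2_norm y)\<^sup>2" using sparse_l1_le_l2[OF sp] y by (simp add: m_def)
  show "(1 - \<epsilon>) * (l2_norm y)\<^sup>2 \<le> (l2_norm (A *\<^sub>v y))\<^sup>2 \<and> (l2_norm (A *\<^sub>v y))\<^sup>2 \<le> (1 + \<epsilon>) * (l2_norm y)\<^sup>2"
  \<comment> \<open>The zero vector cannot be normalised and is treated directly.\<close>
  proof (cases "m = 0")
    case True
    then have "\<forall>l<N. y $ l = 0" by (auto simp: m_def sum_nonneg_eq_0_iff)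
    then have y0: "y = 0\<^sub>v N" using y by auto
    have "A *\<^sub>v y = 0\<^sub>v q" using A unfolding y0 by (intro eq_vecI) auto
    then show ?thesis by (simp add: y0 l2_norm_def L2_set_def)
  next
    case False
    then have m: "m > 0" using sum_nonneg[of "{..<N}" "\<lambda>l. cmod (y $ l)"] by (simp add: m_def)
    define x where "x = complex_of_real (1 / m) \<cdot>\<^sub>v y"
    have x: "x \<in> carrier_vec N" using y by (simp add: x_def)
    have yx: "y = complex_of_real m \<cdot>\<^sub>v x" using m by (simp add: x_def smult_smult_assoc)
    have "(\<Sum>l<N. cmod (x $ l)) = (\<Sum>l<N. cmod (y $ l)) / m"
      unfolding sum_divide_distrib using y m by (intro sum.cong refl) (simp add: x_def norm_mult norm_divide)
    then have x1: "(\<Sum>l<N. cmod (x $ l)) \<le> 1" using m by (simp add: m_def)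
    have Ay: "A *\<^sub>v y = complex_of_real m \<cdot>\<^sub>v (A *\<^sub>v x)"
      unfolding yx using mult_mat_vec[OF A x] by simp
    define a where "a = (l2_norm (A *\<^sub>v x))\<^sup>2"
    define b where "b = (l2_norm x)\<^sup>2"
    have ya: "(l2_norm (A *\<^sub>v y))\<^sup>2 = m\<^sup>2 * a" unfolding Ay by (simp add: l2_norm_smult power_mult_distrib a_def)
    have yb: "(l2_norm y)\<^sup>2 = m\<^sup>2 * b" unfolding yx by (simp add: l2_norm_smult power_mult_distrib b_def)
    have kb: "1 / real k \<le> b" using m_sq m k unfolding yb by (simp add: field_simps)
    have b0: "b \<ge> 0" by (simp add: b_def)
    have "e / real k \<le> e * b" using mult_left_mono[OF kb, of e] e by simp
    then have dev: "\<bar>a - b\<bar> \<le> e * a + 3 * (e * b)"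
      using ball[OF x x1] unfolding a_def[symmetric] b_def[symmetric] by linarith
    \<comment> \<open>The estimate \<open>dev\<close> has \<open>a\<close> on both sides. Solving it
      for \<open>a\<close> gives factors \<open>(1 + 3 * e) / (1 - e)\<close> and
      \<open>(1 - 3 * e) / (1 + e)\<close>, which \<open>e \<le> 1 / 8\<close> keeps within
      \<open>1 + 8 * e\<close> and \<open>1 - 8 * e\<close>.\<close>
    have eb: "(e * b) * e \<le> (e * b) * (1 / 8)" using e b0 by (intro mult_left_mono) auto
    have eb0: "0 \<le> e * b" "0 \<le> (e * b) * e" using e b0 by simp_all
    have "(1 - e) * a = a - e * a" "(1 - e) * ((1 + 8 * e) * b) = b + 7 * (e * b) - 8 * ((e * b) * e)"
      by (simp_all add: algebra_simps)
    then have "(1 - e) * a \<le> (1 - e) * ((1 + 8 * e) * b)" using dev eb eb0 by linarith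
    then have up: "a \<le> (1 + 8 * e) * b" using e by simp
    have "(1 + e) * a = a + e * a" "(1 + e) * ((1 - 8 * e) * b) = b - 7 * (e * b) - 8 * ((e * b) * e)"
      by (simp_all add: algebra_simps)
    then have "(1 + e) * ((1 - 8 * e) * b) \<le> (1 + e) * a" using dev eb0 by linarith
    then have lo: "(1 - 8 * e) * b \<le> a" using e by simp
    have "8 * e * b \<le> \<epsilon> * b" using e b0 by (intro mult_right_mono) auto
    then have "(1 - \<epsilon>) * b \<le> a" "a \<le> (1 + \<epsilon>) * b" using up lo by (simp_all add: algebra_simps)
    then have "m\<^sup>2 * ((1 - \<epsilon>) * b) \<le> m\<^sup>2 * a" "m\<^sup>2 * a \<le> m\<^sup>2 * ((1 + \<epsilon>) * b)"
      by (simp_all add: mult_left_mono)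
    then show ?thesis unfolding ya yb by (simp add: mult.left_commute)
  qed
qed

theorem theorem1p1:
  fixes \<epsilon> K :: real
  assumes "\<epsilon> > 0" and "K > 0"
  shows "\<exists>C::real. C > 0 \<and>
    (\<forall>\<delta>::real. 0 < \<delta> \<and> \<delta> < 1 \<longrightarrow>
      (\<exists>N0::nat. \<forall>(N::nat) (k::nat) (M::complex mat).
        N \<ge> N0 \<longrightarrow> 2 \<le> k \<longrightarrow> k \<le> N \<longrightarrow>
        M \<in> carrier_mat N N \<longrightarrow> unitary_mat M \<longrightarrow>
        (\<forall>i<N. \<forall>j<N. cmod (M $$ (i, j)) \<le> K / sqrt (real N)) \<longrightarrow>
        (\<exists>q::nat. q > 0 \<and>
          real q \<le> C * real k * (ln (real k))\<^sup>2 * ln (real N) \<and>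
          measure_pmf.prob (random_row_sample M q) {A. restricted_isometry A k \<epsilon>} \<ge> 1 - \<delta>)))"
proof -
  \<comment> \<open>The choice of parameters asks for a bound of at least 1 on the scaled entries,
    and enlarging \<open>K\<close> is harmless. The values of \<open>e\<close> and
    \<open>\<eta>\<close> give \<open>8 * e \<le> \<epsilon>\<close> and
    \<open>44 * \<eta> = e\<close>.\<close>
  define K' where "K' = max K 1"
  define e where "e = min \<epsilon> 1 / 8"
  define \<eta> where "\<eta> = e / 44"
  have K': "K' \<ge> 1" "K' > 0" "K \<le> K'" by (auto simp: K'_def)
  have e: "0 < e" "e \<le> 1 / 8" "e \<le> 1" "8 * e \<le> \<epsilon>" using assms by (auto simp: e_def)
  have \<eta>: "0 < \<eta>" "\<eta> \<le> 1" "\<eta> \<le> 1 / 2" "44 * \<eta> = e" using e by (auto simp: \<eta>_def)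
  obtain C c :: real where C: "C > 0" and c: "c > 0"
    and par: "\<And>N k :: nat. 2 \<le> k \<Longrightarrow> k \<le> N \<Longrightarrow> \<exists>q t s p \<alpha>. q > 0 \<and>
        real q \<le> C * real k * (ln (real k))\<^sup>2 * ln (real N) \<and> 0 \<le> p \<and>
        (\<forall>i\<in>{1..t}. s i > 0 \<and> 8 * exp (- (real (s i) * \<eta>\<^sup>2 / (32 * 4 ^ i))) \<le> p) \<and>
        6 * K'\<^sup>2 * real t * p + real t * \<alpha> + K'\<^sup>2 / 4 ^ t \<le> e / real k \<and>
        (\<Sum>i=1..t. real ((4 * N) ^ s i) * (2 * exp (- (e * real q * \<alpha> / (3 * (K' / 2 ^ i)\<^sup>2))))) \<le> c / real N"
    using sampling_parameters[OF K'(1) e(1,3) \<eta>(1,2)] by blast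
  show ?thesis
  proof (intro exI[of _ C] conjI C allI impI)
    fix \<delta> :: real assume \<delta>: "0 < \<delta> \<and> \<delta> < 1"
    show "\<exists>N0::nat. \<forall>(N::nat) (k::nat) (M::complex mat).
        N \<ge> N0 \<longrightarrow> 2 \<le> k \<longrightarrow> k \<le> N \<longrightarrow>
        M \<in> carrier_mat N N \<longrightarrow> unitary_mat M \<longrightarrow>
        (\<forall>i<N. \<forall>j<N. cmod (M $$ (i, j)) \<le> K / sqrt (real N)) \<longrightarrow>
        (\<exists>q::nat. q > 0 \<and>
          real q \<le> C * real k * (ln (real k))\<^sup>2 * ln (real N) \<and>
          measure_pmf.prob (random_row_sample M q) {A. restricted_isometry A k \<epsilon>} \<ge> 1 - \<delta>)"
    \<comment> \<open>Only this threshold depends on \<open>\<delta>\<close>: it brings the failure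
      probability \<open>c / N\<close> below \<open>\<delta>\<close>, while \<open>C\<close> has
      been fixed before.\<close>
    proof (rule exI[of _ "nat \<lceil>c / \<delta>\<rceil>"], intro allI impI)
      fix N k :: nat and M :: "complex mat"
      assume N0: "nat \<lceil>c / \<delta>\<rceil> \<le> N" and k: "2 \<le> k" "k \<le> N" and M: "M \<in> carrier_mat N N" and U: "unitary_mat M"
        and entries: "\<forall>i<N. \<forall>j<N. cmod (M $$ (i, j)) \<le> K / sqrt (real N)"
      have N: "N > 0" using k by simp
      have "c / \<delta> \<le> real N" using N0 by linarith
      then have cN: "c / real N \<le> \<delta>" using \<delta> N by (simp add: field_simps)
      obtain q t s p \<alpha> where q: "q > 0" "real q \<le> C * real k * (ln (real k))\<^sup>2 * ln (real N)" and p: "0 \<le> p"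
        and s: "\<And>i. i \<in> {1..t} \<Longrightarrow> s i > 0 \<and> 8 * exp (- (real (s i) * \<eta>\<^sup>2 / (32 * 4 ^ i))) \<le> p"
        and R: "6 * K'\<^sup>2 * real t * p + real t * \<alpha> + K'\<^sup>2 / 4 ^ t \<le> e / real k"
        and fail: "(\<Sum>i=1..t. real ((4 * N) ^ s i) * (2 * exp (- (e * real q * \<alpha> / (3 * (K' / 2 ^ i)\<^sup>2))))) \<le> c / real N"
        using par[OF k] by blast
      define \<Phi> where "\<Phi> = (\<lambda>j l. complex_of_real (sqrt (real N)) * M $$ (j, l))"
      have \<Phi>: "cmod (\<Phi> j l) \<le> K'" if "j < N" "l < N" for j l
      proof -
        have "cmod (M $$ (j, l)) \<le> K / sqrt (real N)" using entries that by blast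
        then have "cmod (\<Phi> j l) \<le> K" using N by (simp add: \<Phi>_def norm_mult field_simps)
        then show ?thesis using K' by simp
      qed
      let ?P = "Pi_pmf {..<q} 0 (\<lambda>_. pmf_of_set {..<N})"
      define A where "A = (\<lambda>r x. emean q r (\<lambda>j. (cmod (\<Sum>l<N. \<Phi> j l * x l))\<^sup>2))"
      define B where "B = (\<lambda>x. emean N id (\<lambda>j. (cmod (\<Sum>l<N. \<Phi> j l * x l))\<^sup>2))"
      let ?G = "{r. (\<forall>i<q. r i < N) \<and> (\<forall>x. (\<Sum>l<N. cmod (x l)) \<le> 1 \<longrightarrow> \<bar>A r x - B x\<bar> \<le>
        44 * \<eta> * (A r x + B x) + e * B x + 6 * K'\<^sup>2 * real t * p + real t * \<alpha> + K'\<^sup>2 / 4 ^ t)}"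
      have "1 - (\<Sum>i=1..t. real ((4 * N) ^ s i) * (2 * exp (- (e * real q * \<alpha> / (3 * (K' / 2 ^ i)\<^sup>2)))))
          \<le> measure_pmf.prob ?P ?G"
        unfolding A_def B_def
        by (rule subsampling_l1_ball[where \<Phi> = \<Phi> and s = s, OF N q(1) K'(2) e(1,3) \<eta>(1,3) p])
           (rule \<Phi> s; assumption)+
      moreover have "measure_pmf.prob ?P ?G \<le> measure_pmf.prob ?P (sampled_mat M q -` {A. restricted_isometry A k \<epsilon>})"
      proof (rule measure_pmf.finite_measure_mono)
        show "?G \<subseteq> sampled_mat M q -` {A. restricted_isometry A k \<epsilon>}"
        proof
          fix r assume r: "r \<in> ?G"
          have "restricted_isometry (sampled_mat M q r) k \<epsilon>"
          proof (rule restricted_isometry_from_l1_ball[OF sampled_mat_carrier[OF M] _ e(1,2,4)])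
            fix x assume x: "x \<in> carrier_vec N" and x1: "(\<Sum>l<N. cmod (x $ l)) \<le> 1"
            have a: "(l2_norm (sampled_mat M q r *\<^sub>v x))\<^sup>2 = A r (($) x)"
              unfolding A_def \<Phi>_def by (rule l2_norm_sampled_mat[OF M x]) (use r in auto)
            have b: "(l2_norm x)\<^sup>2 = B (($) x)"
              unfolding B_def \<Phi>_def by (rule emean_unitary[OF N M U x, symmetric])
            have "\<bar>A r (($) x) - B (($) x)\<bar> \<le>
              44 * \<eta> * (A r (($) x) + B (($) x)) + e * B (($) x) + 6 * K'\<^sup>2 * real t * p + real t * \<alpha> + K'\<^sup>2 / 4 ^ t"
              using r x1 by blast
            \<comment> \<open>With \<open>44 * \<eta> = e\<close> the relative errors add up to
              \<open>e * A + 2 * e * B\<close>, and \<open>R\<close> bounds the additive ones by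
              \<open>e / k\<close>.\<close>
            then show "\<bar>(l2_norm (sampled_mat M q r *\<^sub>v x))\<^sup>2 - (l2_norm x)\<^sup>2\<bar>
              \<le> e * (l2_norm (sampled_mat M q r *\<^sub>v x))\<^sup>2 + 2 * e * (l2_norm x)\<^sup>2 + e / real k"
              unfolding a b \<eta>(4) distrib_left using R by linarith
          qed (use k in simp)
          then show "r \<in> sampled_mat M q -` {A. restricted_isometry A k \<epsilon>}" by simp
        qed
      qed simp
      moreover have "measure_pmf.prob (random_row_sample M q) {A. restricted_isometry A k \<epsilon>} =
          measure_pmf.prob ?P (sampled_mat M q -` {A. restricted_isometry A k \<epsilon>})"
        using M by (simp add: random_row_sample_def)
      ultimately have "measure_pmf.prob (random_row_sample M q) {A. restricted_isometry A k \<epsilon>} \<ge> 1 - \<delta>"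
        using fail cN by linarith
      with q show "\<exists>q::nat. q > 0 \<and>
          real q \<le> C * real k * (ln (real k))\<^sup>2 * ln (real N) \<and>
          measure_pmf.prob (random_row_sample M q) {A. restricted_isometry A k \<epsilon>} \<ge> 1 - \<delta>" by blast
    qed
  qed
qed

end
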